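(* Let $k\le n$ be positive integers, and let $\alpha_1,\dots,\alpha_k\in\mathbb{Q}$ be distinct rational numbers, with associated point set $Y_{n,k}^{(q)}\subseteq F^n$. Then $\mathbf{T}(Y_{n,k}^{(q)}) = I_{n,k}^{(q)}$, so that we have the identification of quotients $F[x_1,\dots,x_n]/\mathbf{T}(Y_{n,k}^{(q)}) = R_{n,k}^{(q)}$.
   Context: Let $q$ be a formal parameter and $F = \mathbb{Q}(q)$. Hall-Littlewood polynomials: for $d \ge 0$ and $1 \le i \le n$, $P_d(x_1,\dots,x_i;q)\in F[x_1,\dots,x_i]$ is defined by the generating function $\sum_{d\ge 0} (1-q)P_d(x_1,\dots,x_i;q)\, t^d = \prod_{j=1}^i \frac{1-q x_j t}{1-x_j t}$. Let $e_d(x_1,\dots,x_n)$ be the elementary symmetric polynomial of degree $d$. For positive integers $k\le n$, define the ideal $$I_{n,k}^{(q)} := \langle P_k(x_1;q), P_k(x_1,x_2;q),\dots,P_k(x_1,\dots,x_n;q),\ e_n(x_1,\dots,x_n), e_{n-1}(x_1,\dots,x_n),\dots,e_{n-k+1}(x_1,\dots,x_n)\rangle \subseteq F[x_1,\dots,x_n]$$ and $R_{n,k}^{(q)} := F[x_1,\dots,x_n]/I_{n,k}^{(q)}$. Point set: given distinct rational numbers $\alpha_1,\dots,\alpha_k$, let $Y_{n,k}^{(q)}\subseteq F^n$ be the set of points $(y_1,\dots,y_n)$ such that (1) $y_i\in\{q^j\alpha_r : j\ge 0,\ 1\le r\le k\}$ for all $1\le i\le n$; (2) the coordinates $y_1,\dots,y_n$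 are distinct; (3) $\{\alpha_1,\dots,\alpha_k\}\subseteq\{y_1,\dots,y_n\}$; (4) if $y_i=q^j\alpha_r$ for some $1\le i\le n$, $j>0$ and $1\le r\le k$, then there exists $i'<i$ such that $y_{i'}=q^{j-1}\alpha_r$. For a finite set $Y\subseteq F^n$, let $\mathbf{I}(Y) := \{f\in F[x_1,\dots,x_n] : f(\mathbf{y})=0 \text{ for all } \mathbf{y}\in Y\}$ and let $\mathbf{T}(Y) := \langle \tau(f) : f\in \mathbf{I}(Y)-\{0\}\rangle$, where $\tau(f)$ denotes the highest-degree homogeneous component of a nonzero polynomial $f$.
   Formalization: The numbers α_1,…,α_k are additionally assumed nonzero: if some α_r = 0, condition (4) makes the point set empty, so T is the whole ring while I_{n,k} is a proper ideal, and the claim fails. *)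

theory Defs
  imports
    "HOL-Algebra.QuotRing"
    "HOL-Library.Poly_Mapping"
    "HOL-Library.FuncSet"
    "HOL-Computational_Algebra.Formal_Power_Series"
    "HOL-Computational_Algebra.Polynomial_Factorial"
begin

section \<open>The field \<open>F = Q(q)\<close>\<close>

type_synonym F = "rat poly fract"

definition q :: F where
  "q = to_fract [:0, 1:]"

section \<open>Polynomial rings\<close>

text \<open>
  A polynomial is a finitely supported function from monomials to coefficients, and a monomial is
  a finitely supported function from variable indices to exponents. The type contains polynomials
  in all variables \<open>x\<^sub>0, x\<^sub>1, x\<^sub>2, \<dots>\<close>; the ring \<open>F[x\<^sub>1, \<dots>, x\<^sub>n]\<close> is carved out
  by its carrier, so that ideals and quotients are those of \<open>F[x\<^sub>1, \<dots>, x\<^sub>n]\<close>.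
\<close>

type_synonym 'a mpoly = "(nat \<Rightarrow>\<^sub>0 nat) \<Rightarrow>\<^sub>0 'a"

definition const :: "'a::comm_ring_1 \<Rightarrow> 'a mpoly" where
  "const c = Poly_Mapping.single 0 c"

definition var :: "nat \<Rightarrow> 'a::comm_ring_1 mpoly" where
  "var i = Poly_Mapping.single (Poly_Mapping.single i 1) 1"

definition mpoly_ring :: "nat \<Rightarrow> 'a::comm_ring_1 mpoly ring" where
  "mpoly_ring n =
     \<lparr>carrier = {f. \<forall>m\<in>Poly_Mapping.keys f. Poly_Mapping.keys m \<subseteq> {1..n}},
      monoid.mult = (*), one = 1, zero = 0, add = (+)\<rparr>"

definition eval :: "(nat \<Rightarrow> 'a) \<Rightarrow> 'a::comm_ring_1 mpoly \<Rightarrow> 'a" where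
  "eval y f =
     (\<Sum>m\<in>Poly_Mapping.keys f. Poly_Mapping.lookup f m *
        (\<Prod>i\<in>Poly_Mapping.keys m. y i ^ Poly_Mapping.lookup m i))"

definition mon_degree :: "(nat \<Rightarrow>\<^sub>0 nat) \<Rightarrow> nat" where
  "mon_degree m = (\<Sum>i\<in>Poly_Mapping.keys m. Poly_Mapping.lookup m i)"

definition total_degree :: "'a::comm_ring_1 mpoly \<Rightarrow> nat" where
  "total_degree f = Max (mon_degree ` Poly_Mapping.keys f)"

text \<open>The component \<open>\<tau>(f)\<close> of highest degree; only meaningful for \<open>f \<noteq> 0\<close>.\<close>

definition top_component :: "'a::comm_ring_1 mpoly \<Rightarrow> 'a mpoly" where
  "top_component f =
     (\<Sum>m\<in>{m \<in> Poly_Mapping.keys f. mon_degree m = total_degree f}.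
        Poly_Mapping.single m (Poly_Mapping.lookup f m))"

lemma mpoly_ring_cring: "cring (mpoly_ring n :: 'a::comm_ring_1 mpoly ring)"
proof (rule cringI)
  let ?R = "mpoly_ring n :: 'a mpoly ring"
  have add: "f + g \<in> carrier ?R" if "f \<in> carrier ?R" "g \<in> carrier ?R" for f g
    using that Poly_Mapping.keys_add[of f g] by (fastforce simp: mpoly_ring_def)
  have mult: "f * g \<in> carrier ?R" if fg: "f \<in> carrier ?R" "g \<in> carrier ?R" for f g
  proof -
    have "Poly_Mapping.keys m \<subseteq> {1..n}" if m: "m \<in> Poly_Mapping.keys (f * g)" for m
    proof -
      obtain a b where ab: "m = a + b" "a \<in> Poly_Mapping.keys f" "b \<in> Poly_Mapping.keys g"
        using m Poly_Mapping.keys_mult[of f g] by blast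
      have "Poly_Mapping.keys m \<subseteq> Poly_Mapping.keys a \<union> Poly_Mapping.keys b"
        unfolding ab(1) by (rule Poly_Mapping.keys_add)
      with ab fg show ?thesis unfolding mpoly_ring_def by (simp; blast)
    qed
    then show ?thesis by (auto simp: mpoly_ring_def)
  qed
  show "abelian_group ?R"
  proof (rule abelian_groupI)
    fix f assume "f \<in> carrier ?R"
    then show "\<exists>g\<in>carrier ?R. g \<oplus>\<^bsub>?R\<^esub> f = \<zero>\<^bsub>?R\<^esub>"
      by (intro bexI[of _ "- f"]) (auto simp: mpoly_ring_def)
  next
    show "f \<oplus>\<^bsub>?R\<^esub> g \<in> carrier ?R" if "f \<in> carrier ?R" "g \<in> carrier ?R" for f g
      using add[OF that] by (simp add: mpoly_ring_def)
  qed (simp_all add: mpoly_ring_def add.assoc add.commute)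
  show "Group.comm_monoid ?R"
  proof (rule comm_monoidI)
    show "f \<otimes>\<^bsub>?R\<^esub> g \<in> carrier ?R" if "f \<in> carrier ?R" "g \<in> carrier ?R" for f g
      using mult[OF that] by (simp add: mpoly_ring_def)
  qed (simp_all add: mpoly_ring_def mult.assoc mult.commute)
qed (simp add: mpoly_ring_def distrib_right)

section \<open>The ideal and the quotient ring\<close>

text \<open>
  The product of \<open>(1 - q x\<^sub>j t) / (1 - x\<^sub>j t)\<close> over \<open>1 \<le> j \<le> i\<close>, as a power series in \<open>t\<close>
  whose coefficients are polynomials. As these coefficients do not form a field, the reciprocal of
  \<open>1 - x\<^sub>j t\<close> is the library's power series inverse determined by an inverse, here \<open>1\<close>, of the
  constant coefficient.
\<close>

definition hall_littlewood_gf :: "nat \<Rightarrow> F mpoly fps" where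
  "hall_littlewood_gf i =
     (\<Prod>j\<in>{1..i}. (1 - fps_const (const q * var j) * fps_X) *
        fps_right_inverse (1 - fps_const (var j) * fps_X) 1)"

text \<open>\<open>P\<^sub>d(x\<^sub>1, \<dots>, x\<^sub>i; q)\<close>\<close>

definition hall_littlewood :: "nat \<Rightarrow> nat \<Rightarrow> F mpoly" where
  "hall_littlewood d i = const (1 / (1 - q)) * fps_nth (hall_littlewood_gf i) d"

lemma q_neq_1: "q \<noteq> 1"
  unfolding q_def
  by (metis one_pCons pCons_eq_iff to_fract_1 to_fract_eq_iff zero_neq_one)

lemma const_mult: "const a * const b = const (a * b)"
  by (simp add: const_def Poly_Mapping.mult_single)

lemma const_1: "const 1 = 1"
  by (simp add: const_def)

lemma hall_littlewood_generating_function: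
  "Abs_fps (\<lambda>d. const (1 - q) * hall_littlewood d i) * (\<Prod>j\<in>{1..i}. 1 - fps_const (var j) * fps_X)
     = (\<Prod>j\<in>{1..i}. 1 - fps_const (const q * var j) * fps_X)"
proof -
  have "const (1 - q) * const (1 / (1 - q)) = 1"
    using q_neq_1 by (simp add: const_mult const_1)
  then have "const (1 - q) * hall_littlewood d i = fps_nth (hall_littlewood_gf i) d" for d
    by (simp add: hall_littlewood_def mult.assoc[symmetric])
  then have gf: "Abs_fps (\<lambda>d. const (1 - q) * hall_littlewood d i) = hall_littlewood_gf i"
    by (simp add: fps_eq_iff)
  have "(1 - fps_const (var j :: F mpoly) * fps_X) *
      fps_right_inverse (1 - fps_const (var j) * fps_X) 1 = 1" for j
    by (rule fps_right_inverse) simp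
  then have "(1 - fps_const (const q * var j) * fps_X) *
        fps_right_inverse (1 - fps_const (var j) * fps_X) 1 * (1 - fps_const (var j) * fps_X) =
      1 - fps_const (const q * var j :: F mpoly) * fps_X" for j
    by (simp only: mult.assoc mult.commute[of "fps_right_inverse _ _"] mult_1_right)
  then have "hall_littlewood_gf i * (\<Prod>j\<in>{1..i}. 1 - fps_const (var j) * fps_X) =
      (\<Prod>j\<in>{1..i}. 1 - fps_const (const q * var j) * fps_X)"
    unfolding hall_littlewood_gf_def prod.distrib[symmetric] by (intro prod.cong refl)
  with gf show ?thesis
    by simp
qed

definition elem_sym :: "nat \<Rightarrow> nat \<Rightarrow> F mpoly" where
  "elem_sym d n = (\<Sum>S\<in>{S. S \<subseteq> {1..n} \<and> card S = d}. \<Prod>i\<in>S. var i)"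

definition I_ideal :: "nat \<Rightarrow> nat \<Rightarrow> F mpoly set" where
  "I_ideal n k =
     Idl\<^bsub>mpoly_ring n\<^esub>
       (hall_littlewood k ` {1..n} \<union> (\<lambda>d. elem_sym d n) ` {n - k + 1..n})"

definition R_quot :: "nat \<Rightarrow> nat \<Rightarrow> F mpoly set ring" where
  "R_quot n k = mpoly_ring n Quot I_ideal n k"

section \<open>Point sets and their ideals\<close>

text \<open>Points of \<open>F\<^sup>n\<close> are extensional functions on \<open>{1..n}\<close>.\<close>

definition point_set :: "nat \<Rightarrow> nat \<Rightarrow> (nat \<Rightarrow> rat) \<Rightarrow> (nat \<Rightarrow> F) set" where
  "point_set n k \<alpha> =
     {y \<in> {1..n} \<rightarrow>\<^sub>E UNIV.
        (\<forall>i\<in>{1..n}. y i \<in> {q ^ j * of_rat (\<alpha> r) | j r. r \<in> {1..k}}) \<and>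
        inj_on y {1..n} \<and>
        (\<lambda>r. of_rat (\<alpha> r)) ` {1..k} \<subseteq> y ` {1..n} \<and>
        (\<forall>i\<in>{1..n}. \<forall>j>0. \<forall>r\<in>{1..k}. y i = q ^ j * of_rat (\<alpha> r) \<longrightarrow>
           (\<exists>i'\<in>{1..<i}. y i' = q ^ (j - 1) * of_rat (\<alpha> r)))}"

text \<open>
  If some \<open>\<alpha>\<^sub>r\<close> is zero, the last condition applied to \<open>0 = q \<cdot> \<alpha>\<^sub>r\<close> asks for a second zero
  coordinate, so there are no points.
\<close>

lemma point_set_empty_if_zero:
  assumes "r \<in> {1..k}" "\<alpha> r = 0"
  shows "point_set n k \<alpha> = {}"
proof (rule equals0I)
  fix y assume y: "y \<in> point_set n k \<alpha>"
  then have "of_rat (\<alpha> r) \<in> y ` {1..n}"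
    using assms(1) by (auto simp: point_set_def)
  then obtain i where i: "i \<in> {1..n}" "y i = 0"
    using assms(2) by auto
  then have "y i = q ^ 1 * of_rat (\<alpha> r)"
    using assms(2) by simp
  moreover have "\<forall>i\<in>{1..n}. \<forall>j>0. \<forall>r\<in>{1..k}. y i = q ^ j * of_rat (\<alpha> r) \<longrightarrow>
      (\<exists>i'\<in>{1..<i}. y i' = q ^ (j - 1) * of_rat (\<alpha> r))"
    using y by (simp add: point_set_def)
  ultimately have "\<exists>i'\<in>{1..<i}. y i' = q ^ (1 - 1) * of_rat (\<alpha> r)"
    using i(1) assms(1) zero_less_one by metis
  then obtain i' where i': "i' \<in> {1..<i}" "y i' = 0"
    using assms(2) by auto
  have "inj_on y {1..n}"
    using y by (simp add: point_set_def)
  then have "i' = i"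
    by (rule inj_onD) (use i i' in auto)
  then show False
    using i'(1) by simp
qed

definition vanishing_ideal :: "nat \<Rightarrow> (nat \<Rightarrow> F) set \<Rightarrow> F mpoly set" where
  "vanishing_ideal n Y = {f \<in> carrier (mpoly_ring n). \<forall>y\<in>Y. eval y f = 0}"

definition T_ideal :: "nat \<Rightarrow> (nat \<Rightarrow> F) set \<Rightarrow> F mpoly set" where
  "T_ideal n Y = Idl\<^bsub>mpoly_ring n\<^esub> (top_component ` (vanishing_ideal n Y - {0}))"

end

theory Submission
  imports Defs
begin

text \<open>
  Write \<open>Y\<close> for the point set, \<open>V\<close> for its vanishing ideal, \<open>I\<close> for the ideal generated by the
  Hall-Littlewood polynomials \<open>P\<^sub>k(x\<^sub>1, \<dots>, x\<^sub>i)\<close> and the elementary symmetric polynomials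
  \<open>e\<^sub>d\<close> with \<open>d > n - k\<close>, and \<open>T\<close> for the ideal of top components of \<open>V\<close>. The proof shows
  \<open>I \<subseteq> T\<close> by exhibiting elements of \<open>V\<close>, and the converse by comparing the size of \<open>F[x] / I\<close>
  with the number of points.

  \<open>I \<subseteq> T\<close>. A point of \<open>Y\<close> arises from a surjection \<open>g\<close> from \<open>{1..n}\<close> onto \<open>{1..k}\<close>: the
  coordinates in the fibre of \<open>r\<close> are, from left to right, \<open>\<alpha>\<^sub>r, q \<alpha>\<^sub>r, q\<^sup>2 \<alpha>\<^sub>r\<close> and so on. On
  such a point the product \<open>\<Prod> (1 - q y\<^sub>j t) / (1 - y\<^sub>j t)\<close> over a prefix \<open>j \<le> i\<close> telescopes in each
  fibre; multiplied by \<open>\<Prod> (1 - \<alpha>\<^sub>r t)\<close> it becomes \<open>\<Prod> (1 - q\<^bsup>c r\<^esup> \<alpha>\<^sub>r t)\<close>, where the numbers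
  \<open>c r\<close> sum to \<open>i\<close>. So the coefficient of \<open>t\<^sup>k\<close> takes the same value \<open>(-1)\<^sup>k q\<^sup>i \<Prod> \<alpha>\<^sub>r\<close> at all
  points (\<open>hl_series_on_point_set\<close>). As every \<open>\<alpha>\<^sub>r\<close> is a coordinate,
  \<open>\<Prod> (1 + y\<^sub>i t) / \<Prod> (1 + \<alpha>\<^sub>r t)\<close> is a polynomial of degree \<open>n - k\<close>, and its higher coefficients
  vanish (\<open>elem_series_on_point_set\<close>). Both facts say that a generator plus
  terms of lower degree lies in \<open>V\<close> (\<open>leading_form_of_constant\<close>).

  \<open>T \<subseteq> I\<close>. The monomials of a set \<open>M\<close> with \<open>card M \<le> card Y\<close> span \<open>F[x] / I\<close>
  (\<open>spanning_monomials\<close> and \<open>point_set_large\<close>). Dividing step by step from the top degree, every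
  polynomial is congruent modulo \<open>V\<close> to a combination of \<open>M\<close> without rise of degree
  (\<open>reduction_modulo_vanishing\<close>). Hence the combinations of \<open>M\<close> realise all functions on \<open>Y\<close>, and
  by the count of \<open>M\<close> none but \<open>0\<close> vanishes on \<open>Y\<close> (\<open>vanishing_eq_0\<close>). Reducing an element of
  \<open>V\<close> therefore leaves \<open>0\<close>, so the very first step of the reduction shows that its top component
  lies in \<open>I\<close>.

  The spanning set comes from filtering by the powers of \<open>x\<^sub>1\<close>. Modulo \<open>x\<^sub>1\<close> each generator becomes
  the analogous polynomial in \<open>x\<^sub>2, \<dots>, x\<^sub>n\<close>, and \<open>x\<^sub>1\<^sup>k \<in> I\<close>. If the elementary generators are
  those with \<open>d > n - s\<close>, then \<open>x\<^sub>1\<^sup>s e\<^bsub>n-s\<^esub>(x\<^sub>2, \<dots>, x\<^sub>n)\<close> also lies in the ideal, so the layers of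
  \<open>x\<^sub>1\<^sup>j\<close> with \<open>s \<le> j < k\<close> satisfy one more relation than those with \<open>j < s\<close>. The resulting
  recursion for the number of monomials is the one that counts the maps from an \<open>n\<close>-element set to
  a \<open>k\<close>-element set whose image contains \<open>s\<close> given elements.
\<close>

section \<open>Polynomials as finitely supported functions\<close>

abbreviation single where "single \<equiv> Poly_Mapping.single"
abbreviation lookup where "lookup \<equiv> Poly_Mapping.lookup"
abbreviation keys where "keys \<equiv> Poly_Mapping.keys"

lemma poly_mapping_sum_singles:
  fixes f :: "'b \<Rightarrow>\<^sub>0 'a::comm_monoid_add"
  shows "f = (\<Sum>m\<in>keys f. single m (lookup f m))"
  by (rule poly_mapping_eqI)
    (auto simp: lookup_sum lookup_single when_def not_in_keys_iff_lookup_eq_zero)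

lemma keys_subset_induct [consumes 1, case_names zero single add]:
  fixes f :: "'b \<Rightarrow>\<^sub>0 'a::comm_monoid_add"
  assumes "keys f \<subseteq> M"
    and "P 0"
    and "\<And>m c. m \<in> M \<Longrightarrow> P (single m c)"
    and "\<And>g h. P g \<Longrightarrow> P h \<Longrightarrow> P (g + h)"
  shows "P f"
proof -
  have "P (\<Sum>m\<in>A. single m (lookup f m))" if "finite A" "A \<subseteq> M" for A
    using that by (induction A) (auto intro: assms)
  from this[of "keys f"] assms(1) show ?thesis
    using poly_mapping_sum_singles[of f] by simp
qed

definition monom_val :: "(nat \<Rightarrow> 'a) \<Rightarrow> (nat \<Rightarrow>\<^sub>0 nat) \<Rightarrow> 'a::comm_ring_1" where
  "monom_val y m = (\<Prod>i\<in>keys m. y i ^ lookup m i)"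

lemma monom_val_superset:
  assumes "finite A" "keys m \<subseteq> A"
  shows "monom_val y m = (\<Prod>i\<in>A. y i ^ lookup m i)"
  unfolding monom_val_def
  by (rule prod.mono_neutral_left) (use assms in \<open>auto simp: in_keys_iff\<close>)

lemma monom_val_0 [simp]: "monom_val y 0 = 1"
  by (simp add: monom_val_def)

lemma monom_val_add: "monom_val y (m + m') = monom_val y m * monom_val y m'"
proof -
  let ?A = "keys m \<union> keys m'"
  have "monom_val y (m + m') = (\<Prod>i\<in>?A. y i ^ lookup (m + m') i)"
    by (rule monom_val_superset) (use Poly_Mapping.keys_add[of m m'] in auto)
  also have "\<dots> = (\<Prod>i\<in>?A. y i ^ lookup m i) * (\<Prod>i\<in>?A. y i ^ lookup m' i)"
    by (simp add: lookup_add power_add prod.distrib)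
  finally show ?thesis
    by (simp add: monom_val_superset[of ?A])
qed

lemma eval_superset:
  assumes "finite M" "keys f \<subseteq> M"
  shows "eval y f = (\<Sum>m\<in>M. lookup f m * monom_val y m)"
  unfolding eval_def monom_val_def[symmetric]
  by (rule sum.mono_neutral_left) (use assms in \<open>auto simp: in_keys_iff\<close>)

lemma eval_single: "eval y (single m c) = c * monom_val y m"
  by (subst eval_superset[of "{m}"]) auto

lemma eval_0 [simp]: "eval y 0 = 0"
  by (simp add: eval_def)

lemma eval_add [simp]: "eval y (f + g) = eval y f + eval y g"
proof -
  let ?M = "keys f \<union> keys g"
  have "eval y (f + g) = (\<Sum>m\<in>?M. lookup (f + g) m * monom_val y m)"
    by (rule eval_superset) (use Poly_Mapping.keys_add[of f g] in auto)
  also have "\<dots> = (\<Sum>m\<in>?M. lookup f m * monom_val y m) + (\<Sum>m\<in>?M. lookup g m * monom_val y m)"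
    by (simp add: lookup_add distrib_right sum.distrib)
  finally show ?thesis
    by (simp add: eval_superset[of ?M])
qed

lemma eval_mult [simp]: "eval y (f * g) = eval y f * eval y g"
proof (induction f rule: keys_subset_induct[OF subset_UNIV, case_names zero single add])
  case (single m c)
  show ?case
    by (induction g rule: keys_subset_induct[OF subset_UNIV, case_names zero single add])
      (auto simp: eval_single Poly_Mapping.mult_single monom_val_add algebra_simps)
qed (auto simp: algebra_simps)

lemma eval_const [simp]: "eval y (const c) = c"
  by (simp add: const_def eval_single)

lemma eval_1 [simp]: "eval y 1 = 1"
  by (metis eval_const const_1)

lemma eval_var [simp]: "eval y (var i) = y i"
  by (simp add: var_def eval_single monom_val_def)

lemma eval_diff [simp]: "eval y (f - g) = eval y f - eval y g"
  by (metis eval_add eq_diff_eq diff_add_cancel)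

lemma eval_sum [simp]: "eval y (\<Sum>a\<in>A. f a) = (\<Sum>a\<in>A. eval y (f a))"
  by (induction A rule: infinite_finite_induct) auto

lemma eval_prod [simp]: "eval y (\<Prod>a\<in>A. f a) = (\<Prod>a\<in>A. eval y (f a))"
  by (induction A rule: infinite_finite_induct) auto

section \<open>The ring in finitely many variables and its ideals\<close>

lemma mem_carrier_iff: "f \<in> carrier (mpoly_ring n) \<longleftrightarrow> keys f \<subseteq> {m. keys m \<subseteq> {1..n}}"
  by (auto simp: mpoly_ring_def)

lemma carrier_add: "f \<in> carrier (mpoly_ring n) \<Longrightarrow> g \<in> carrier (mpoly_ring n) \<Longrightarrow>
    f + g \<in> carrier (mpoly_ring n)"
  using cring.cring_simprules(1)[OF mpoly_ring_cring, of f n g] by (simp add: mpoly_ring_def)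

lemma carrier_mult: "f \<in> carrier (mpoly_ring n) \<Longrightarrow> g \<in> carrier (mpoly_ring n) \<Longrightarrow>
    f * g \<in> carrier (mpoly_ring n)"
  using cring.cring_simprules(5)[OF mpoly_ring_cring, of f n g] by (simp add: mpoly_ring_def)

lemma carrier_0: "0 \<in> carrier (mpoly_ring n)"
  by (simp add: mpoly_ring_def)

lemma carrier_const: "const c \<in> carrier (mpoly_ring n)"
  by (auto simp: mpoly_ring_def const_def)

lemma carrier_1: "1 \<in> carrier (mpoly_ring n)"
  using carrier_const[of 1] by (simp add: const_1)

lemma carrier_var: "i \<in> {1..n} \<Longrightarrow> var i \<in> carrier (mpoly_ring n)"
  by (auto simp: mpoly_ring_def var_def)

lemma carrier_uminus: "f \<in> carrier (mpoly_ring n) \<Longrightarrow> - f \<in> carrier (mpoly_ring n)"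
  by (simp add: mpoly_ring_def)

lemma carrier_diff: "f \<in> carrier (mpoly_ring n) \<Longrightarrow> g \<in> carrier (mpoly_ring n) \<Longrightarrow>
    f - g \<in> carrier (mpoly_ring n)"
  using carrier_add[of f n "- g"] carrier_uminus[of g n] by simp

lemma carrier_sum: "(\<And>a. a \<in> A \<Longrightarrow> f a \<in> carrier (mpoly_ring n)) \<Longrightarrow>
    (\<Sum>a\<in>A. f a) \<in> carrier (mpoly_ring n)"
  by (induction A rule: infinite_finite_induct) (auto intro: carrier_0 carrier_add)

lemma carrier_prod: "(\<And>a. a \<in> A \<Longrightarrow> f a \<in> carrier (mpoly_ring n)) \<Longrightarrow>
    (\<Prod>a\<in>A. f a) \<in> carrier (mpoly_ring n)"
  by (induction A rule: infinite_finite_induct) (auto intro: carrier_1 carrier_mult)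

lemma carrier_power: "f \<in> carrier (mpoly_ring n) \<Longrightarrow> f ^ j \<in> carrier (mpoly_ring n)"
  by (induction j) (auto intro: carrier_1 carrier_mult)

lemmas carrier_intros = carrier_0 carrier_1 carrier_const carrier_var carrier_add carrier_mult
  carrier_uminus carrier_diff carrier_sum carrier_prod carrier_power

lemma mpoly_idealI:
  fixes J :: "'a::comm_ring_1 mpoly set"
  assumes "J \<subseteq> carrier (mpoly_ring n)" and "0 \<in> J"
    and add: "\<And>f g. f \<in> J \<Longrightarrow> g \<in> J \<Longrightarrow> f + g \<in> J"
    and mult: "\<And>c f. c \<in> carrier (mpoly_ring n) \<Longrightarrow> f \<in> J \<Longrightarrow> c * f \<in> J"
  shows "ideal J (mpoly_ring n)"
proof -
  interpret R: cring "mpoly_ring n :: 'a mpoly ring"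
    by (rule mpoly_ring_cring)
  have neg: "\<ominus>\<^bsub>mpoly_ring n\<^esub> f = - f" if "f \<in> carrier (mpoly_ring n)" for f :: "'a mpoly"
    by (rule R.minus_equality) (use that in \<open>auto simp: mpoly_ring_def\<close>)
  have mult_right: "f * c \<in> J" if "c \<in> carrier (mpoly_ring n)" "f \<in> J" for c f
    using mult[OF that] by (simp add: mult.commute)
  have minus: "- f \<in> J" if "f \<in> J" for f
    using mult[OF carrier_uminus[OF carrier_1] that] by simp
  have "subgroup J (add_monoid (mpoly_ring n))"
  proof (rule group.subgroupI)
    show "Group.group (add_monoid (mpoly_ring n :: 'a mpoly ring))"
      by (rule R.a_group)
    show "inv\<^bsub>add_monoid (mpoly_ring n)\<^esub> f \<in> J" if "f \<in> J" for f
      using neg[of f] minus[OF that] that assms(1) by (auto simp: a_inv_def)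
  qed (use assms in \<open>auto simp: mpoly_ring_def\<close>)
  then show ?thesis
    by (rule idealI[OF R.ring_axioms])
      (use mult mult_right in \<open>auto simp: mpoly_ring_def\<close>)
qed

lemma
  assumes "ideal J (mpoly_ring n)"
  shows ideal_carrier: "f \<in> J \<Longrightarrow> f \<in> carrier (mpoly_ring n)"
    and ideal_0: "0 \<in> J"
    and ideal_add: "f \<in> J \<Longrightarrow> g \<in> J \<Longrightarrow> f + g \<in> J"
    and ideal_mult: "c \<in> carrier (mpoly_ring n) \<Longrightarrow> f \<in> J \<Longrightarrow> c * f \<in> J"
    and ideal_mult_right: "c \<in> carrier (mpoly_ring n) \<Longrightarrow> f \<in> J \<Longrightarrow> f * c \<in> J"
    and ideal_diff: "f \<in> J \<Longrightarrow> g \<in> J \<Longrightarrow> f - g \<in> J"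
proof -
  interpret J: ideal J "mpoly_ring n"
    by fact
  show "f \<in> J \<Longrightarrow> f \<in> carrier (mpoly_ring n)"
    by (rule J.Icarr)
  show "0 \<in> J"
    using additive_subgroup.zero_closed[OF J.is_additive_subgroup] by (simp add: mpoly_ring_def)
  show add: "f + g \<in> J" if "f \<in> J" "g \<in> J" for f g
    using additive_subgroup.a_closed[OF J.is_additive_subgroup that] by (simp add: mpoly_ring_def)
  show mult: "c * f \<in> J" if "c \<in> carrier (mpoly_ring n)" "f \<in> J" for c f
    using J.I_l_closed[OF that(2,1)] by (simp add: mpoly_ring_def)
  then show "f * c \<in> J" if "c \<in> carrier (mpoly_ring n)" "f \<in> J"
    using that by (simp add: mult.commute)
  show "f - g \<in> J" if "f \<in> J" "g \<in> J"
    using add[OF that(1) mult[OF carrier_uminus[OF carrier_1] that(2)]] by simp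
qed

lemma vanishing_ideal_ideal: "ideal (vanishing_ideal n Y) (mpoly_ring n)"
  by (rule mpoly_idealI) (auto simp: vanishing_ideal_def intro: carrier_intros)


section \<open>Homogeneous components\<close>

lemma mon_degree_superset:
  assumes "finite A" "keys m \<subseteq> A"
  shows "mon_degree m = (\<Sum>i\<in>A. lookup m i)"
  unfolding mon_degree_def
  by (rule sum.mono_neutral_left) (use assms in \<open>auto simp: in_keys_iff\<close>)

lemma mon_degree_add: "mon_degree (m + m') = mon_degree m + mon_degree m'"
proof -
  let ?A = "keys m \<union> keys m'"
  have "mon_degree (m + m') = (\<Sum>i\<in>?A. lookup (m + m') i)"
    by (rule mon_degree_superset) (use Poly_Mapping.keys_add[of m m'] in auto)
  then show ?thesis
    by (simp add: lookup_add sum.distrib mon_degree_superset[of ?A])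
qed

lemma mon_degree_0 [simp]: "mon_degree 0 = 0"
  by (simp add: mon_degree_def)

lemma mon_degree_single [simp]: "mon_degree (single i j) = j"
  by (simp add: mon_degree_def)

definition component :: "nat \<Rightarrow> 'a::comm_ring_1 mpoly \<Rightarrow> 'a mpoly" where
  "component d f = (\<Sum>m\<in>{m \<in> keys f. mon_degree m = d}. single m (lookup f m))"

lemma lookup_component: "lookup (component d f) m = (lookup f m when mon_degree m = d)"
  by (auto simp: component_def lookup_sum lookup_single when_def not_in_keys_iff_lookup_eq_zero)

lemma component_0 [simp]: "component d 0 = 0"
  by (simp add: component_def)

lemma component_add: "component d (f + g) = component d f + component d g"
  by (rule poly_mapping_eqI) (simp add: lookup_component lookup_add when_def)

lemma component_diff: "component d (f - g) = component d f - component d g"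
  by (rule poly_mapping_eqI) (simp add: lookup_component lookup_minus when_def)

lemma component_sum: "component d (\<Sum>a\<in>A. f a) = (\<Sum>a\<in>A. component d (f a))"
  by (induction A rule: infinite_finite_induct) (auto simp: component_add)

lemma component_single: "component d (single m c) = (if mon_degree m = d then single m c else 0)"
  by (rule poly_mapping_eqI) (auto simp: lookup_component lookup_single when_def)

lemma keys_component: "keys (component d f) = {m \<in> keys f. mon_degree m = d}"
  by (auto simp: in_keys_iff lookup_component)

lemma component_component: "component e (component d f) = (if e = d then component d f else 0)"
  by (rule poly_mapping_eqI) (auto simp: lookup_component when_def)

lemma component_eqI:
  assumes "\<And>d. component d f = component d g"
  shows "f = g"
proof (rule poly_mapping_eqI)
  fix m
  show "lookup f m = lookup g m"
    using arg_cong[OF assms[of "mon_degree m"], of "\<lambda>h. lookup h m"] by (simp add: lookup_component)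
qed

lemma component_carrier: "f \<in> carrier (mpoly_ring n) \<Longrightarrow> component d f \<in> carrier (mpoly_ring n)"
  by (auto simp: mpoly_ring_def keys_component)

lemma component_single_mult:
  "component d (single m c * f) =
     (if mon_degree m \<le> d then single m c * component (d - mon_degree m) f else 0)"
proof (induction f rule: keys_subset_induct[OF subset_UNIV, case_names zero single add])
  case (single m' c')
  show ?case
    by (auto simp: component_single Poly_Mapping.mult_single mon_degree_add)
qed (auto simp: algebra_simps component_add)

definition homogeneous :: "nat \<Rightarrow> 'a::comm_ring_1 mpoly \<Rightarrow> bool" where
  "homogeneous d f \<longleftrightarrow> (\<forall>m\<in>keys f. mon_degree m = d)"

lemma homogeneous_0 [simp]: "homogeneous d 0"
  by (simp add: homogeneous_def)

lemma homogeneous_add: "homogeneous d f \<Longrightarrow> homogeneous d g \<Longrightarrow> homogeneous d (f + g)"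
  unfolding homogeneous_def using Poly_Mapping.keys_add[of f g] by blast

lemma homogeneous_sum: "(\<And>a. a \<in> A \<Longrightarrow> homogeneous d (f a)) \<Longrightarrow> homogeneous d (\<Sum>a\<in>A. f a)"
  by (induction A rule: infinite_finite_induct) (auto intro: homogeneous_add)

lemma homogeneous_mult: "homogeneous d f \<Longrightarrow> homogeneous e g \<Longrightarrow> homogeneous (d + e) (f * g)"
  unfolding homogeneous_def using Poly_Mapping.keys_mult[of f g] by (auto simp: mon_degree_add)

lemma homogeneous_const [simp]: "homogeneous 0 (const c)"
  by (simp add: homogeneous_def const_def)

lemma homogeneous_1 [simp]: "homogeneous 0 1"
  by (metis homogeneous_const const_1)

lemma homogeneous_var: "homogeneous 1 (var i)"
  by (simp add: homogeneous_def var_def)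

lemma homogeneous_power: "homogeneous 1 f \<Longrightarrow> homogeneous j (f ^ j)"
proof (induction j)
  case (Suc j)
  then show ?case
    using homogeneous_mult[of 1 f j "f ^ j"] by simp
qed simp

lemma component_homogeneous: "homogeneous d f \<Longrightarrow> component e f = (if e = d then f else 0)"
  by (rule poly_mapping_eqI)
    (auto simp: homogeneous_def lookup_component when_def in_keys_iff)

text \<open>
  For an ideal \<open>V\<close> and \<open>h\<close> homogeneous of degree \<open>d\<close> this asks that \<open>h\<close> be zero or the top
  component of an element of \<open>V\<close>. Allowing zero makes the forms of degree \<open>d\<close> a vector space.
\<close>

definition leading_form_in :: "'a::comm_ring_1 mpoly set \<Rightarrow> nat \<Rightarrow> 'a mpoly \<Rightarrow> bool" where
  "leading_form_in V d h \<longleftrightarrow> (\<exists>v\<in>V. \<forall>e\<ge>d. component e v = (if e = d then h else 0))"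

text \<open>
  This lets statements about all elements of an ideal be checked on homogeneous generators: the
  polynomials whose components lie in \<open>I\<close> and are leading forms of \<open>V\<close> are closed under
  multiplication because a monomial factor shifts components by its degree.
\<close>

lemma leading_forms_ideal:
  fixes V :: "'a::comm_ring_1 mpoly set"
  assumes V: "ideal V (mpoly_ring n)" and I: "ideal I (mpoly_ring n)"
  shows "ideal {f \<in> carrier (mpoly_ring n). \<forall>d. component d f \<in> I \<and> leading_form_in V d (component d f)}
    (mpoly_ring n)" (is "ideal ?G _")
proof (rule mpoly_idealI)
  show G0: "0 \<in> ?G"
    using ideal_0[OF V] ideal_0[OF I] by (auto simp: leading_form_in_def intro: carrier_0 bexI[of _ 0])
  show add: "f + g \<in> ?G" if "f \<in> ?G" "g \<in> ?G" for f g
  proof -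
    have "leading_form_in V d (component d (f + g))" for d
    proof -
      have "leading_form_in V d (component d f)" "leading_form_in V d (component d g)"
        using that by blast+
      then obtain v w where "v \<in> V" "\<forall>e\<ge>d. component e v = (if e = d then component d f else 0)"
        and "w \<in> V" "\<forall>e\<ge>d. component e w = (if e = d then component d g else 0)"
        unfolding leading_form_in_def by metis
      then show ?thesis
        unfolding leading_form_in_def
        by (intro bexI[of _ "v + w"]) (auto simp: component_add intro: ideal_add[OF V])
    qed
    then show ?thesis
      using that by (auto simp: component_add intro: carrier_add ideal_add[OF I])
  qed
  show "c * f \<in> ?G" if "c \<in> carrier (mpoly_ring n)" and f: "f \<in> ?G" for c f
  proof -
    from that(1) have "keys c \<subseteq> {m. keys m \<subseteq> {1..n}}"
      by (simp add: mem_carrier_iff)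
    then show ?thesis
    proof (induction c rule: keys_subset_induct)
      case zero
      then show ?case using G0 by simp
    next
      case (single m c)
      have c: "single m c \<in> carrier (mpoly_ring n)"
        using single by (auto simp: mem_carrier_iff)
      have "leading_form_in V d (component d (single m c * f)) \<and> component d (single m c * f) \<in> I" for d
      proof (cases "mon_degree m \<le> d")
        case True
        obtain v where v: "v \<in> V"
          "\<forall>e\<ge>d - mon_degree m. component e v = (if e = d - mon_degree m then component (d - mon_degree m) f else 0)"
          using f unfolding leading_form_in_def by blast
        have "\<forall>e\<ge>d. component e (single m c * v) = (if e = d then component d (single m c * f) else 0)"
          using v(2) True by (auto simp: component_single_mult)
        then have "leading_form_in V d (component d (single m c * f))"
          unfolding leading_form_in_def using ideal_mult[OF V c v(1)] by blast
        moreover have "single m c * component (d - mon_degree m) f \<in> I"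
          using f ideal_mult[OF I c] by blast
        ultimately show ?thesis
          using True by (simp add: component_single_mult)
      next
        case False
        then show ?thesis
          using G0 by (simp add: component_single_mult)
      qed
      then show ?case
        using carrier_mult[OF c] f by simp
    next
      case (add g h)
      then show ?case
        using \<open>\<And>g f. f \<in> ?G \<Longrightarrow> g \<in> ?G \<Longrightarrow> f + g \<in> ?G\<close>[of "g * f" "h * f"]
        unfolding distrib_right by blast
    qed
  qed
qed auto

section \<open>Graded power series\<close>

definition graded :: "nat \<Rightarrow> 'a::comm_ring_1 mpoly fps \<Rightarrow> bool" where
  "graded n \<Phi> \<longleftrightarrow> (\<forall>d. fps_nth \<Phi> d \<in> carrier (mpoly_ring n) \<and> homogeneous d (fps_nth \<Phi> d))"

lemma graded_1: "graded n 1"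
  by (simp add: graded_def carrier_0 carrier_1)

lemma graded_mult:
  assumes "graded n \<Phi>" "graded n \<Psi>"
  shows "graded n (\<Phi> * \<Psi>)"
proof -
  have "homogeneous d (fps_nth \<Phi> i * fps_nth \<Psi> (d - i))" if "i \<le> d" for d i
    using homogeneous_mult[of i "fps_nth \<Phi> i" "d - i" "fps_nth \<Psi> (d - i)"] assms that
    by (simp add: graded_def)
  then show ?thesis
    using assms unfolding graded_def fps_mult_nth
    by (auto intro!: carrier_sum carrier_mult homogeneous_sum)
qed

lemma graded_prod: "(\<And>a. a \<in> A \<Longrightarrow> graded n (\<Phi> a)) \<Longrightarrow> graded n (\<Prod>a\<in>A. \<Phi> a)"
  by (induction A rule: infinite_finite_induct) (auto intro: graded_1 graded_mult)

text \<open>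
  Over a commutative ring a right inverse is unique, so it suffices that the geometric series is one.
\<close>

lemma fps_right_inverse_geometric:
  fixes v :: "'a::comm_ring_1"
  shows "fps_right_inverse (1 - fps_const v * fps_X) 1 = Abs_fps (\<lambda>m. v ^ m)" (is "?R = ?G")
proof -
  let ?D = "1 - fps_const v * fps_X"
  have DG: "?D * ?G = 1"
  proof (rule fps_ext)
    show "fps_nth (?D * ?G) d = fps_nth 1 d" for d
      by (cases d) (simp_all add: algebra_simps)
  qed
  have "?D * ?R = 1"
    by (rule fps_right_inverse) simp
  then have "?R = ?R * (?D * ?G)"
    using DG by simp
  also have "\<dots> = (?D * ?R) * ?G"
    by (simp only: mult.assoc mult.commute[of ?R] mult.left_commute)
  finally show ?thesis
    using \<open>?D * ?R = 1\<close> by simp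
qed


section \<open>The generating series of the generators\<close>

lemma const_diff: "const (a - b) = const a - const b"
  by (simp add: const_def Poly_Mapping.single_diff)

text \<open>
  \<open>hall_littlewood_gf\<close> for an arbitrary set of variables, since the spanning argument works with the
  variables \<open>x\<^sub>a, \<dots>, x\<^sub>l\<close>.
\<close>

definition hl_series :: "nat set \<Rightarrow> F mpoly fps" where
  "hl_series A = (\<Prod>j\<in>A. (1 - fps_const (const q * var j) * fps_X) *
     fps_right_inverse (1 - fps_const (var j) * fps_X) 1)"

lemma hl_factor_nth:
  "fps_nth ((1 - fps_const (const q * var j) * fps_X) *
     fps_right_inverse (1 - fps_const (var j) * fps_X) 1) d =
     (if d = 0 then 1 else const (1 - q) * (var j :: F mpoly) ^ d)"
proof (cases d)
  case 0
  then show ?thesis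
    by (simp add: fps_right_inverse_geometric)
next
  case (Suc d')
  then show ?thesis
    by (simp add: fps_right_inverse_geometric left_diff_distrib mult.assoc const_diff const_1)
qed

lemma hl_series_eq_hall_littlewood:
  "fps_nth (hl_series {1..i}) d = const (1 - q) * hall_littlewood d i"
proof -
  have "const (1 - q) * const (1 / (1 - q)) = 1"
    using q_neq_1 by (simp add: const_mult const_1)
  then show ?thesis
    by (simp add: hall_littlewood_def hall_littlewood_gf_def hl_series_def mult.assoc[symmetric])
qed

lemma hall_littlewood_eq_hl_series:
  "hall_littlewood d i = const (1 / (1 - q)) * fps_nth (hl_series {1..i}) d"
  by (simp add: hall_littlewood_def hall_littlewood_gf_def hl_series_def)

lemma graded_hl_series:
  assumes "A \<subseteq> {1..n}"
  shows "graded n (hl_series A)"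
  unfolding hl_series_def
proof (rule graded_prod)
  fix j assume "j \<in> A"
  then have j: "j \<in> {1..n}"
    using assms by auto
  have "homogeneous (0 + d) (const (1 - q) * (var j :: F mpoly) ^ d)" for d
    by (intro homogeneous_mult homogeneous_const homogeneous_power homogeneous_var)
  then show "graded n ((1 - fps_const (const q * var j) * fps_X) *
      fps_right_inverse (1 - fps_const (var j) * fps_X) (1 :: F mpoly))"
    using j unfolding graded_def hl_factor_nth
    by (auto intro!: carrier_1 carrier_mult carrier_const carrier_power carrier_var)
qed

lemma hl_series_singleton:
  assumes "d > 0"
  shows "fps_nth (hl_series {j}) d = const (1 - q) * var j ^ d"
  using assms hl_factor_nth[of j d] by (simp add: hl_series_def)

text \<open>
  The factor of a new variable \<open>x\<^sub>j\<close> is \<open>1\<close> at \<open>x\<^sub>j = 0\<close>, so modulo \<open>x\<^sub>j\<close> it does not change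
  the coefficients.
\<close>

lemma hl_series_insert:
  assumes "finite A" "j \<notin> A" "insert j A \<subseteq> {1..n}"
  obtains g where "g \<in> carrier (mpoly_ring n)"
    and "fps_nth (hl_series (insert j A)) d = fps_nth (hl_series A) d + var j * g"
proof -
  let ?g = "\<Sum>i=1..d. const (1 - q) * var j ^ (i - 1) * fps_nth (hl_series A) (d - i)"
  have "fps_nth (hl_series (insert j A)) d =
      (\<Sum>i=0..d. (if i = 0 then 1 else const (1 - q) * var j ^ i) * fps_nth (hl_series A) (d - i))"
    unfolding hl_series_def prod.insert[OF assms(1,2)] fps_mult_nth[of _ _ d] hl_factor_nth ..
  also have "\<dots> = fps_nth (hl_series A) d +
      (\<Sum>i=1..d. (if i = 0 then 1 else const (1 - q) * var j ^ i) * fps_nth (hl_series A) (d - i))"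
    by (simp add: sum.atLeast_Suc_atMost)
  also have "(\<Sum>i=1..d. (if i = 0 then 1 else const (1 - q) * var j ^ i) * fps_nth (hl_series A) (d - i)) =
      var j * ?g"
    unfolding sum_distrib_left
    by (rule sum.cong) (auto simp: power_eq_if mult_ac)
  finally have "fps_nth (hl_series (insert j A)) d = fps_nth (hl_series A) d + var j * ?g" .
  moreover have "?g \<in> carrier (mpoly_ring n)"
    using assms(3) graded_hl_series[of A n] unfolding graded_def
    by (intro carrier_intros) auto
  ultimately show thesis
    using that by blast
qed

definition elem_series :: "nat set \<Rightarrow> F mpoly fps" where
  "elem_series A = (\<Prod>j\<in>A. 1 + fps_const (var j) * fps_X)"

lemma elem_factor_nth:
  "fps_nth (1 + fps_const (var j) * fps_X) d = (if d = 0 then 1 else if d = 1 then (var j :: F mpoly) else 0)"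
  by (cases d) auto

lemma graded_elem_series:
  assumes "A \<subseteq> {1..n}"
  shows "graded n (elem_series A)"
  unfolding elem_series_def
proof (rule graded_prod)
  fix j assume "j \<in> A"
  then have "(var j :: F mpoly) \<in> carrier (mpoly_ring n)"
    using assms by (intro carrier_var) blast
  then show "graded n (1 + fps_const (var j) * fps_X :: F mpoly fps)"
    using homogeneous_var[of j] unfolding graded_def elem_factor_nth
    by (simp add: carrier_0 carrier_1)
qed

lemma elem_series_empty: "fps_nth (elem_series {}) d = (if d = 0 then 1 else 0)"
  by (simp add: elem_series_def)

lemma elem_series_nth_0: "fps_nth (elem_series A) 0 = 1"
  unfolding elem_series_def by (induction A rule: infinite_finite_induct) auto

lemma elem_series_insert_Suc:
  assumes "finite A" "j \<notin> A"
  shows "fps_nth (elem_series (insert j A)) (Suc d) =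
    fps_nth (elem_series A) (Suc d) + var j * fps_nth (elem_series A) d"
  using assms by (simp add: elem_series_def distrib_right mult.assoc)

lemma fps_const_prod: "(\<Prod>a\<in>A. fps_const (c a)) = fps_const (\<Prod>a\<in>A. c a :: 'a::comm_ring_1)"
  by (induction A rule: infinite_finite_induct) auto

lemma elem_series_eq_elem_sym: "fps_nth (elem_series {1..n}) d = elem_sym d n"
proof -
  have monomials: "(\<Prod>j\<in>S. fps_const (var j :: F mpoly) * fps_X) =
      fps_const (\<Prod>j\<in>S. var j) * fps_X ^ card S" for S
    by (simp only: prod.distrib fps_const_prod prod_constant)
  have "elem_series {1..n} = (\<Prod>j\<in>{1..n}. fps_const (var j) * fps_X + 1)"
    by (simp add: elem_series_def add.commute)
  also have "\<dots> = (\<Sum>S\<in>Pow {1..n}. fps_const (\<Prod>j\<in>S. var j) * fps_X ^ card S)"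
    by (simp add: prod_add monomials)
  finally have "elem_series {1..n} = \<dots>" .
  then have "fps_nth (elem_series {1..n}) d = (\<Sum>S\<in>Pow {1..n}. (\<Prod>j\<in>S. var j) * (if d = card S then 1 else 0))"
    by (simp add: fps_sum_nth)
  also have "\<dots> = elem_sym d n"
    unfolding elem_sym_def
    by (rule sum.mono_neutral_cong_right) auto
  finally show ?thesis .
qed

lemma elem_series_nth_eq_0:
  assumes "finite A" "card A < d"
  shows "fps_nth (elem_series A) d = 0"
  using assms
proof (induction A arbitrary: d)
  case empty
  then show ?case by (simp add: elem_series_empty)
next
  case (insert j A)
  then obtain d' where "d = Suc d'"
    by (cases d) auto
  with insert show ?case
    by (simp add: elem_series_insert_Suc)
qed


section \<open>The generators on the point set\<close>

text \<open>
  A rational number is \<open>c / d\<close> with integers \<open>c\<close> and \<open>d\<close>, and both embeddings agree on integers.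
\<close>

lemma of_rat_F: "(of_rat a :: F) = to_fract [:a:]"
proof -
  have nat: "(of_nat z :: F) = to_fract (of_nat z)" for z
    by (induction z) simp_all
  have "(of_int z :: F) = to_fract (of_int z)" for z
    by (cases z) (simp_all add: nat)
  then have int: "(of_int z :: F) = to_fract [:of_int z:]" for z
    by (simp add: of_int_poly)
  obtain c d where cd: "quotient_of a = (c, d)"
    by fastforce
  then have d: "d > 0" and a: "a = of_int c / of_int d"
    using quotient_of_denom_pos quotient_of_div by auto
  then have "to_fract [:a:] * (of_int d :: F) = of_int c"
    unfolding int by (simp add: to_fract_mult[symmetric])
  moreover have "(of_rat a :: F) * of_int d = of_int c"
    using d unfolding a by (simp add: of_rat_divide)
  moreover have "(of_int d :: F) \<noteq> 0"
    using d by simp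
  ultimately show ?thesis
    by (metis mult_right_cancel)
qed

text \<open>
  The points live in \<open>\<rat>[q]\<close>, where coordinates are monomials; this makes the exponent and the
  rational factor of a coordinate unique.
\<close>

lemma q_power_mult_of_rat: "q ^ j * of_rat a = to_fract (monom a j)"
  by (induction j) (simp_all add: of_rat_F q_def monom_0 monom_Suc mult.assoc to_fract_mult[symmetric])

lemma q_power_mult_of_rat_eq_iff:
  assumes "a \<noteq> 0" "b \<noteq> 0"
  shows "q ^ i * of_rat a = q ^ j * of_rat b \<longleftrightarrow> i = j \<and> a = b"
  using assms by (auto simp: q_power_mult_of_rat monom_eq_iff')

text \<open>
  Here \<open>c r\<close> is the number of \<open>j \<le> i\<close> with \<open>y j\<close> of the form \<open>q\<^sup>m \<alpha>\<^sub>r\<close>. A new coordinate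
  \<open>q\<^sup>m \<alpha>\<^sub>r\<close> is distinct from the earlier ones, so \<open>m \<ge> c r\<close>, and its predecessor \<open>q\<^bsup>m-1\<^esup> \<alpha>\<^sub>r\<close>
  occurs earlier, so \<open>m \<le> c r\<close>. Passing from \<open>i\<close> to \<open>i + 1\<close> thus multiplies both sides of the
  product formula by the same two linear factors.
\<close>

lemma point_set_prefix:
  assumes y: "y \<in> point_set n k \<alpha>"
    and \<alpha>: "inj_on \<alpha> {1..k}" "\<forall>r\<in>{1..k}. \<alpha> r \<noteq> 0"
    and "i \<le> n"
  shows "\<exists>c. (\<Sum>r\<in>{1..k}. c r) = i \<and>
    y ` {1..i} = {q ^ j * of_rat (\<alpha> r) | j r. r \<in> {1..k} \<and> j < c r} \<and>
    (\<Prod>j\<in>{1..i}. 1 - fps_const (q * y j) * fps_X) *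
      (\<Prod>r\<in>{1..k}. 1 - fps_const (of_rat (\<alpha> r)) * fps_X) =
    (\<Prod>r\<in>{1..k}. 1 - fps_const (q ^ c r * of_rat (\<alpha> r)) * fps_X) *
      (\<Prod>j\<in>{1..i}. 1 - fps_const (y j) * fps_X)"
  using \<open>i \<le> n\<close>
proof (induction i)
  case 0
  show ?case
    by (rule exI[of _ "\<lambda>_. 0"]) auto
next
  case (Suc i)
  let ?K = "{1..k}"
  let ?a = "\<lambda>r. of_rat (\<alpha> r) :: F"
  let ?f = "\<lambda>r c. 1 - fps_const (q ^ c * ?a r) * fps_X"
  obtain c where c: "(\<Sum>r\<in>?K. c r) = i"
    and img: "y ` {1..i} = {q ^ j * ?a r | j r. r \<in> ?K \<and> j < c r}"
    and prods: "(\<Prod>j\<in>{1..i}. 1 - fps_const (q * y j) * fps_X) * (\<Prod>r\<in>?K. 1 - fps_const (?a r) * fps_X) =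
      (\<Prod>r\<in>?K. ?f r (c r)) * (\<Prod>j\<in>{1..i}. 1 - fps_const (y j) * fps_X)"
    using Suc.IH[OF Suc_leD[OF Suc.prems]] by blast
  have range: "\<forall>i\<in>{1..n}. y i \<in> {q ^ j * ?a r | j r. r \<in> ?K}"
    and inj: "inj_on y {1..n}"
    and pred: "\<forall>i\<in>{1..n}. \<forall>j>0. \<forall>r\<in>?K. y i = q ^ j * ?a r \<longrightarrow>
      (\<exists>i'\<in>{1..<i}. y i' = q ^ (j - 1) * ?a r)"
    using y unfolding point_set_def mem_Collect_eq by blast+
  have "Suc i \<in> {1..n}"
    using Suc.prems by simp
  with range have "y (Suc i) \<in> {q ^ j * ?a r | j r. r \<in> ?K}"
    by blast
  then obtain j r where r: "r \<in> ?K" and yi: "y (Suc i) = q ^ j * ?a r"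
    by blast
  have "y (Suc i) \<notin> y ` {1..i}"
    using inj_on_image_mem_iff[OF inj, of "Suc i" "{1..i}"] Suc.prems by auto
  then have "c r \<le> j"
    unfolding img yi using r by (metis (mono_tags, lifting) mem_Collect_eq not_le)
  moreover have "j \<le> c r"
  proof (cases "j = 0")
    case False
    then obtain i' where "i' \<in> {1..<Suc i}" "y i' = q ^ (j - 1) * ?a r"
      using pred[rule_format, of "Suc i" j r] \<open>Suc i \<in> {1..n}\<close> r yi by blast
    then have "q ^ (j - 1) * ?a r \<in> y ` {1..i}"
      unfolding atLeastLessThanSuc_atLeastAtMost by (metis imageI)
    then obtain j' r' where "q ^ (j - 1) * ?a r = q ^ j' * ?a r'" "r' \<in> ?K" "j' < c r'"
      unfolding img by blast
    moreover from this have "j - 1 = j'" "\<alpha> r = \<alpha> r'"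
      using q_power_mult_of_rat_eq_iff[of "\<alpha> r" "\<alpha> r'" "j - 1" j'] \<alpha>(2) r by blast+
    moreover have "r = r'"
      by (rule inj_onD[OF \<alpha>(1)]) fact+
    ultimately show ?thesis
      by simp
  qed simp
  ultimately have j: "j = c r"
    by simp
  define c' where "c' = c(r := Suc (c r))"
  have split: "(\<Prod>s\<in>?K. ?f s (d s)) = ?f r (d r) * (\<Prod>s\<in>?K - {r}. ?f s (d s))" for d :: "nat \<Rightarrow> nat"
    by (rule prod.remove) (use r in auto)
  have rest: "(\<Prod>s\<in>?K - {r}. ?f s (c' s)) = (\<Prod>s\<in>?K - {r}. ?f s (c s))"
    by (rule prod.cong) (auto simp: c'_def)
  have "(\<Sum>s\<in>?K. c' s) = c' r + (\<Sum>s\<in>?K - {r}. c' s)"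
    by (rule sum.remove) (use r in auto)
  also have "(\<Sum>s\<in>?K - {r}. c' s) = (\<Sum>s\<in>?K - {r}. c s)"
    by (rule sum.cong) (auto simp: c'_def)
  also have "c' r + \<dots> = Suc (\<Sum>s\<in>?K. c s)"
    using sum.remove[of ?K r c] r by (simp add: c'_def)
  finally have sum: "(\<Sum>s\<in>?K. c' s) = Suc i"
    using c by simp
  have "y ` {1..Suc i} = insert (q ^ c r * ?a r) (y ` {1..i})"
    using yi j by (auto simp: atLeastAtMostSuc_conv)
  also have "\<dots> = {q ^ j * ?a s | j s. s \<in> ?K \<and> j < c' s}"
  proof -
    have "s \<in> ?K \<and> j < c' s \<longleftrightarrow> s \<in> ?K \<and> j < c s \<or> j = c r \<and> s = r" for j s
      using r by (auto simp: c'_def)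
    then show ?thesis
      unfolding img by blast
  qed
  finally have img': "y ` {1..Suc i} = \<dots>" .
  let ?Pq = "\<Prod>j\<in>{1..i}. 1 - fps_const (q * y j) * fps_X"
  let ?P = "\<Prod>j\<in>{1..i}. 1 - fps_const (y j) * fps_X"
  let ?A = "\<Prod>r\<in>?K. 1 - fps_const (?a r) * fps_X"
  let ?B = "\<Prod>s\<in>?K - {r}. ?f s (c s)"
  have new: "(\<Prod>s\<in>?K. ?f s (c' s)) = ?f r (Suc (c r)) * ?B"
    by (simp only: split rest) (simp add: c'_def)
  have new': "(\<Prod>j\<in>{1..Suc i}. 1 - fps_const (y j) * fps_X) = ?f r (c r) * ?P"
    using yi j by (simp add: atLeastAtMostSuc_conv)
  have "(\<Prod>j\<in>{1..Suc i}. 1 - fps_const (q * y j) * fps_X) * ?A = ?f r (Suc (c r)) * (?Pq * ?A)"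
    using yi j by (simp add: atLeastAtMostSuc_conv mult.assoc)
  also have "\<dots> = ?f r (Suc (c r)) * (?f r (c r) * ?B * ?P)"
    unfolding prods split[of c] ..
  also have "\<dots> = (\<Prod>s\<in>?K. ?f s (c' s)) * (\<Prod>j\<in>{1..Suc i}. 1 - fps_const (y j) * fps_X)"
    unfolding new new' by (simp only: mult_ac)
  finally have "(\<Prod>j\<in>{1..Suc i}. 1 - fps_const (q * y j) * fps_X) * ?A =
      (\<Prod>s\<in>?K. ?f s (c' s)) * (\<Prod>j\<in>{1..Suc i}. 1 - fps_const (y j) * fps_X)" .
  then show ?case
    using sum img' by blast
qed

definition eval_fps :: "(nat \<Rightarrow> 'a) \<Rightarrow> 'a::comm_ring_1 mpoly fps \<Rightarrow> 'a fps" where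
  "eval_fps y \<Phi> = Abs_fps (\<lambda>d. eval y (fps_nth \<Phi> d))"

lemma eval_fps_mult: "eval_fps y (\<Phi> * \<Psi>) = eval_fps y \<Phi> * eval_fps y \<Psi>"
  by (rule fps_ext) (simp add: eval_fps_def fps_mult_nth)

lemma eval_fps_1: "eval_fps y 1 = 1"
  by (rule fps_ext) (simp add: eval_fps_def)

lemma eval_fps_prod: "eval_fps y (\<Prod>a\<in>A. \<Phi> a) = (\<Prod>a\<in>A. eval_fps y (\<Phi> a))"
  by (induction A rule: infinite_finite_induct) (auto simp: eval_fps_mult eval_fps_1)

lemma eval_fps_linear:
  "eval_fps y (1 - fps_const f * fps_X) = 1 - fps_const (eval y f) * fps_X"
  "eval_fps y (1 + fps_const f * fps_X) = 1 + fps_const (eval y f) * fps_X"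
proof -
  show "eval_fps y (1 - fps_const f * fps_X) = 1 - fps_const (eval y f) * fps_X"
  proof (rule fps_ext)
    show "fps_nth (eval_fps y (1 - fps_const f * fps_X)) d = fps_nth (1 - fps_const (eval y f) * fps_X) d" for d
      by (cases d) (auto simp: eval_fps_def)
  qed
  show "eval_fps y (1 + fps_const f * fps_X) = 1 + fps_const (eval y f) * fps_X"
  proof (rule fps_ext)
    show "fps_nth (eval_fps y (1 + fps_const f * fps_X)) d = fps_nth (1 + fps_const (eval y f) * fps_X) d" for d
      by (cases d) (auto simp: eval_fps_def)
  qed
qed

lemma eval_hl_series:
  "eval_fps y (hl_series A) * (\<Prod>j\<in>A. 1 - fps_const (y j) * fps_X) =
    (\<Prod>j\<in>A. 1 - fps_const (q * y j) * fps_X)"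
proof -
  have "(1 - fps_const (var j :: F mpoly) * fps_X) *
      fps_right_inverse (1 - fps_const (var j) * fps_X) 1 = 1" for j
    by (rule fps_right_inverse) simp
  then have "(1 - fps_const (const q * var j) * fps_X) *
        fps_right_inverse (1 - fps_const (var j) * fps_X) 1 * (1 - fps_const (var j) * fps_X) =
      1 - fps_const (const q * var j :: F mpoly) * fps_X" for j
    by (simp only: mult.assoc mult.commute[of "fps_right_inverse _ _"] mult_1_right)
  then have "hl_series A * (\<Prod>j\<in>A. 1 - fps_const (var j) * fps_X) =
      (\<Prod>j\<in>A. 1 - fps_const (const q * var j) * fps_X)"
    unfolding hl_series_def prod.distrib[symmetric] by (intro prod.cong refl)
  from arg_cong[OF this, of "eval_fps y"] show ?thesis
    by (simp add: eval_fps_mult eval_fps_prod eval_fps_linear)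
qed

lemma linear_fps_prod_nth:
  fixes c :: "'b \<Rightarrow> 'a::comm_ring_1"
  assumes "finite A"
  shows "fps_nth (\<Prod>a\<in>A. 1 - fps_const (c a) * fps_X) (card A) = (\<Prod>a\<in>A. - c a)"
    and "card A < d \<Longrightarrow> fps_nth (\<Prod>a\<in>A. 1 - fps_const (c a) * fps_X) d = 0"
proof -
  have "fps_nth (\<Prod>a\<in>A. 1 - fps_const (c a) * fps_X) (card A) = (\<Prod>a\<in>A. - c a) \<and>
      (\<forall>d>card A. fps_nth (\<Prod>a\<in>A. 1 - fps_const (c a) * fps_X) d = 0)"
    using assms
  proof (induction A)
    case (insert b A)
    let ?p = "\<Prod>a\<in>A. 1 - fps_const (c a) * fps_X"
    have "fps_nth (\<Prod>a\<in>insert b A. 1 - fps_const (c a) * fps_X) (Suc d) =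
        fps_nth ?p (Suc d) - c b * fps_nth ?p d" for d
      using insert.hyps by (simp add: left_diff_distrib mult.assoc)
    with insert show ?case
      by (auto simp: gr0_conv_Suc Suc_less_eq2)
  qed auto
  then show "fps_nth (\<Prod>a\<in>A. 1 - fps_const (c a) * fps_X) (card A) = (\<Prod>a\<in>A. - c a)"
    and "card A < d \<Longrightarrow> fps_nth (\<Prod>a\<in>A. 1 - fps_const (c a) * fps_X) d = 0"
    by auto
qed

lemma fps_prod_nth_0: "fps_nth (\<Prod>a\<in>A. f a) 0 = (\<Prod>a\<in>A. fps_nth (f a :: 'a::comm_ring_1 fps) 0)"
  by (induction A rule: infinite_finite_induct) auto

text \<open>
  By \<open>point_set_prefix\<close> the product on the left is a product of \<open>k\<close> linear factors, whose top coefficient depends on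
  the point only through the sum of the exponents \<open>c r\<close>, which is \<open>i\<close>.
\<close>

lemma hl_series_on_point_set:
  assumes y: "y \<in> point_set n k \<alpha>"
    and \<alpha>: "inj_on \<alpha> {1..k}" "\<forall>r\<in>{1..k}. \<alpha> r \<noteq> 0"
    and "i \<le> n"
  shows "fps_nth (eval_fps y (hl_series {1..i}) *
      (\<Prod>r\<in>{1..k}. 1 - fps_const (of_rat (\<alpha> r)) * fps_X)) k =
    (-1) ^ k * q ^ i * (\<Prod>r\<in>{1..k}. of_rat (\<alpha> r))"
proof -
  let ?A = "\<Prod>r\<in>{1..k}. 1 - fps_const (of_rat (\<alpha> r) :: F) * fps_X"
  let ?P = "\<Prod>j\<in>{1..i}. 1 - fps_const (y j) * fps_X"
  obtain c where c: "(\<Sum>r\<in>{1..k}. c r) = i" and prods: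
    "(\<Prod>j\<in>{1..i}. 1 - fps_const (q * y j) * fps_X) * ?A =
      (\<Prod>r\<in>{1..k}. 1 - fps_const (q ^ c r * of_rat (\<alpha> r)) * fps_X) * ?P"
    using point_set_prefix[OF assms] by auto
  have "1 - fps_const (y j) * fps_X \<noteq> 0" for j
  proof
    assume "1 - fps_const (y j) * fps_X = 0"
    then have "fps_nth (1 - fps_const (y j) * fps_X) 0 = 0"
      by simp
    then show False
      by simp
  qed
  then have "?P \<noteq> 0"
    by simp
  moreover have "eval_fps y (hl_series {1..i}) * ?A * ?P =
      (\<Prod>r\<in>{1..k}. 1 - fps_const (q ^ c r * of_rat (\<alpha> r)) * fps_X) * ?P"
  proof -
    have "eval_fps y (hl_series {1..i}) * ?A * ?P = (eval_fps y (hl_series {1..i}) * ?P) * ?A"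
      by (simp only: mult_ac)
    then show ?thesis
      by (simp only: eval_hl_series prods)
  qed
  ultimately have "eval_fps y (hl_series {1..i}) * ?A =
      (\<Prod>r\<in>{1..k}. 1 - fps_const (q ^ c r * of_rat (\<alpha> r)) * fps_X)"
    by simp
  then have "fps_nth (eval_fps y (hl_series {1..i}) * ?A) k = (\<Prod>r\<in>{1..k}. - (q ^ c r * of_rat (\<alpha> r)))"
    using linear_fps_prod_nth(1)[of "{1..k}" "\<lambda>r. q ^ c r * of_rat (\<alpha> r)"] by simp
  also have "\<dots> = (-1) ^ k * q ^ i * (\<Prod>r\<in>{1..k}. of_rat (\<alpha> r))"
    using c by (simp add: prod_uminus prod.distrib power_sum[symmetric])
  finally show ?thesis .
qed

text \<open>
  Every \<open>\<alpha>\<^sub>r\<close> is a coordinate exactly once; the factors of these coordinates cancel, and \<open>n - k\<close>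
  linear factors remain.
\<close>

lemma elem_series_on_point_set:
  assumes y: "y \<in> point_set n k \<alpha>"
    and \<alpha>: "inj_on \<alpha> {1..k}"
    and d: "n < d + k"
  shows "fps_nth (eval_fps y (elem_series {1..n}) *
      inverse (\<Prod>r\<in>{1..k}. 1 + fps_const (of_rat (\<alpha> r)) * fps_X)) d = 0"
proof -
  let ?B = "(\<lambda>r. of_rat (\<alpha> r) :: F) ` {1..k}"
  define S where "S = {i \<in> {1..n}. y i \<in> ?B}"
  let ?A = "\<Prod>r\<in>{1..k}. 1 + fps_const (of_rat (\<alpha> r) :: F) * fps_X"
  have inj: "inj_on y {1..n}" and cover: "?B \<subseteq> y ` {1..n}"
    using y by (simp_all add: point_set_def)
  have S: "S \<subseteq> {1..n}" "inj_on y S"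
    unfolding S_def using inj by (blast, blast intro: inj_on_subset)
  have S_img: "y ` S = ?B"
  proof (intro equalityI subsetI)
    fix v assume v: "v \<in> ?B"
    then obtain i where "i \<in> {1..n}" "v = y i"
      using cover by (metis imageE subsetD)
    with v show "v \<in> y ` S"
      by (simp add: S_def)
  qed (auto simp: S_def)
  have inj_rat: "inj_on (\<lambda>r. of_rat (\<alpha> r) :: F) {1..k}"
  proof (rule inj_onI)
    fix r s assume rs: "r \<in> {1..k}" "s \<in> {1..k}" and "(of_rat (\<alpha> r) :: F) = of_rat (\<alpha> s)"
    then have "\<alpha> r = \<alpha> s"
      by (simp only: of_rat_eq_iff)
    then show "r = s"
      using inj_onD[OF \<alpha>] rs by blast
  qed
  have "card S = card ?B"
    using card_image[OF S(2)] S_img by simp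
  also have "\<dots> = k"
    using card_image[OF inj_rat] by simp
  finally have card_S: "card S = k" .
  then have card: "card ({1..n} - S) = n - k"
    using S(1) by (simp add: card_Diff_subset finite_subset)
  have "k \<le> n"
    using card_mono[OF _ S(1)] card_S by simp
  have "(\<Prod>i\<in>S. 1 + fps_const (y i) * fps_X) = (\<Prod>v\<in>?B. 1 + fps_const v * fps_X)"
    unfolding S_img[symmetric] by (simp add: prod.reindex[OF S(2)])
  also have "\<dots> = ?A"
    by (simp only: prod.reindex[OF inj_rat] o_def)
  finally have prodS: "(\<Prod>i\<in>S. 1 + fps_const (y i) * fps_X) = ?A" .
  have "eval_fps y (elem_series {1..n}) = (\<Prod>i\<in>{1..n}. 1 + fps_const (y i) * fps_X)"
    by (simp add: elem_series_def eval_fps_prod eval_fps_linear)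
  also have "\<dots> = (\<Prod>i\<in>{1..n} - S. 1 + fps_const (y i) * fps_X) * ?A"
    using prod.subset_diff[OF S(1), of "\<lambda>i. 1 + fps_const (y i) * fps_X"] prodS by simp
  finally have "eval_fps y (elem_series {1..n}) * inverse ?A =
      (\<Prod>i\<in>{1..n} - S. 1 + fps_const (y i) * fps_X) * (inverse ?A * ?A)"
    by (simp only: mult_ac)
  also have "inverse ?A * ?A = 1"
    by (rule inverse_mult_eq_1) (simp add: fps_prod_nth_0)
  finally have "eval_fps y (elem_series {1..n}) * inverse ?A =
      (\<Prod>i\<in>{1..n} - S. 1 - fps_const (- y i) * fps_X)"
    by (simp flip: fps_const_neg)
  then show ?thesis
    using linear_fps_prod_nth(2)[of "{1..n} - S" d "\<lambda>i. - y i"] card d \<open>k \<le> n\<close> by simp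
qed

text \<open>
  The coefficient of \<open>t\<^sup>d\<close> in \<open>\<Phi> U\<close> is \<open>\<Phi>\<^sub>d\<close> plus terms of lower degree, because the coefficients of
  \<open>U\<close> are scalars; subtracting the constant \<open>c\<close> gives a polynomial that vanishes on \<open>Y\<close>.
\<close>

lemma leading_form_of_constant:
  fixes \<Phi> :: "F mpoly fps"
  assumes \<Phi>: "graded n \<Phi>" and U: "fps_nth U 0 = 1" and "d > 0"
    and const: "\<And>y. y \<in> Y \<Longrightarrow> fps_nth (eval_fps y \<Phi> * U) d = c"
  shows "leading_form_in (vanishing_ideal n Y) d (fps_nth \<Phi> d)"
proof -
  let ?t = "\<lambda>i. fps_nth \<Phi> i * const (fps_nth U (d - i))"
  define v where "v = (\<Sum>i=0..d. ?t i) - const c"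
  have "v \<in> carrier (mpoly_ring n)"
    using \<Phi> unfolding v_def graded_def
    by (intro carrier_diff carrier_sum carrier_mult carrier_const) auto
  moreover have "eval y v = 0" if "y \<in> Y" for y
    using const[OF that] by (simp add: v_def eval_fps_def fps_mult_nth)
  moreover have "component e v = (if e = d then fps_nth \<Phi> d else 0)" if "e \<ge> d" for e
  proof -
    have "homogeneous i (?t i)" for i
      using homogeneous_mult[OF _ homogeneous_const, of i "fps_nth \<Phi> i"] \<Phi> by (simp add: graded_def)
    then have "component e (?t i) = (if e = i then ?t i else 0)" for i
      by (rule component_homogeneous)
    then have "component e v = (\<Sum>i=0..d. if e = i then ?t i else 0) - component e (const c)"
      unfolding v_def component_diff component_sum by simp
    also have "component e (const c) = 0"
      using that \<open>d > 0\<close> by (simp add: component_homogeneous[OF homogeneous_const])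
    also have "(\<Sum>i=0..d. if e = i then ?t i else 0) = (if e = d then fps_nth \<Phi> d else 0)"
      using that U by (simp add: const_1)
    finally show ?thesis
      by simp
  qed
  ultimately show ?thesis
    unfolding leading_form_in_def vanishing_ideal_def by blast
qed

lemma leading_form_hl_series:
  assumes "1 \<le> k" "i \<le> n" "inj_on \<alpha> {1..k}" "\<forall>r\<in>{1..k}. \<alpha> r \<noteq> 0"
  shows "leading_form_in (vanishing_ideal n (point_set n k \<alpha>)) k (fps_nth (hl_series {1..i}) k)"
  by (rule leading_form_of_constant[OF graded_hl_series _ _ hl_series_on_point_set])
    (use assms in \<open>auto simp: fps_prod_nth_0\<close>)

lemma leading_form_elem_sym:
  assumes "inj_on \<alpha> {1..k}" "d \<in> {n - k + 1..n}"
  shows "leading_form_in (vanishing_ideal n (point_set n k \<alpha>)) d (elem_sym d n)"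
  unfolding elem_series_eq_elem_sym[symmetric]
  by (rule leading_form_of_constant[OF graded_elem_series _ _ elem_series_on_point_set])
    (use assms in \<open>auto simp: fps_prod_nth_0\<close>)


section \<open>A spanning set of monomials modulo the ideal\<close>

text \<open>
  The number of maps from a \<open>b\<close>-element set to a \<open>k\<close>-element set whose image contains \<open>s\<close> given
  elements: a new argument is sent either to one of these elements, which then need not be hit again,
  or to one of the \<open>k - s\<close> others.
\<close>

fun cover_number :: "nat \<Rightarrow> nat \<Rightarrow> nat \<Rightarrow> nat" where
  "cover_number k 0 s = (if s = 0 then 1 else 0)"
| "cover_number k (Suc b) s = s * cover_number k b (s - 1) + (k - s) * cover_number k b s"

text \<open>
  The possible coefficients of \<open>x\<^sup>j\<close> in elements of \<open>J\<close> divisible by \<open>x\<^sup>j\<close>, up to multiples of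
  \<open>x\<close>: it describes the layer \<open>x\<^sup>j F[x] / x\<^bsup>j+1\<^esup> F[x]\<close> of the quotient by \<open>J\<close>.
\<close>

definition trailing_ideal :: "nat \<Rightarrow> 'a::comm_ring_1 mpoly set \<Rightarrow> 'a mpoly \<Rightarrow> nat \<Rightarrow> 'a mpoly set" where
  "trailing_ideal n J x j =
     {f \<in> carrier (mpoly_ring n). \<exists>g\<in>carrier (mpoly_ring n). x ^ j * f - x ^ Suc j * g \<in> J}"

lemma trailing_ideal_ideal:
  assumes J: "ideal J (mpoly_ring n)"
  shows "ideal (trailing_ideal n J x j) (mpoly_ring n)"
proof (rule mpoly_idealI)
  show "0 \<in> trailing_ideal n J x j"
    using ideal_0[OF J] unfolding trailing_ideal_def
    by (intro CollectI conjI bexI[of _ 0] carrier_0) simp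
  show "f + g \<in> trailing_ideal n J x j"
    if f: "f \<in> trailing_ideal n J x j" and g: "g \<in> trailing_ideal n J x j" for f g
  proof -
    obtain f' where f': "f' \<in> carrier (mpoly_ring n)" "x ^ j * f - x ^ Suc j * f' \<in> J"
      using f unfolding trailing_ideal_def by blast
    obtain g' where g': "g' \<in> carrier (mpoly_ring n)" "x ^ j * g - x ^ Suc j * g' \<in> J"
      using g unfolding trailing_ideal_def by blast
    have "x ^ j * (f + g) - x ^ Suc j * (f' + g') =
        (x ^ j * f - x ^ Suc j * f') + (x ^ j * g - x ^ Suc j * g')"
      by (simp add: algebra_simps)
    also have "\<dots> \<in> J"
      by (rule ideal_add[OF J f'(2) g'(2)])
    finally show ?thesis
      using f g carrier_add f'(1) g'(1) unfolding trailing_ideal_def by blast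
  qed
  show "c * f \<in> trailing_ideal n J x j"
    if c: "c \<in> carrier (mpoly_ring n)" and f: "f \<in> trailing_ideal n J x j" for c f
  proof -
    obtain f' where f': "f' \<in> carrier (mpoly_ring n)" "x ^ j * f - x ^ Suc j * f' \<in> J"
      using f unfolding trailing_ideal_def by blast
    have "x ^ j * (c * f) - x ^ Suc j * (c * f') = c * (x ^ j * f - x ^ Suc j * f')"
      by (simp add: algebra_simps)
    also have "\<dots> \<in> J"
      by (rule ideal_mult[OF J c f'(2)])
    finally show ?thesis
      using f carrier_mult[OF c] f'(1) unfolding trailing_ideal_def by blast
  qed
qed (auto simp: trailing_ideal_def)

lemma trailing_idealI:
  assumes "f \<in> carrier (mpoly_ring n)" "x ^ j * f \<in> J"
  shows "f \<in> trailing_ideal n J x j"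
  using assms unfolding trailing_ideal_def
  by (intro CollectI conjI bexI[of _ 0] carrier_0) simp_all

lemma trailing_idealI_mod:
  assumes J: "ideal J (mpoly_ring n)" and "x \<in> carrier (mpoly_ring n)"
    and "f + x * g \<in> J" "f \<in> carrier (mpoly_ring n)" "g \<in> carrier (mpoly_ring n)"
  shows "f \<in> trailing_ideal n J x j"
proof -
  have "x ^ j * f - x ^ Suc j * (- g) = x ^ j * (f + x * g)"
    by (simp add: algebra_simps)
  also have "\<dots> \<in> J"
    using assms by (intro ideal_mult[OF J] carrier_power)
  finally show ?thesis
    using assms carrier_uminus unfolding trailing_ideal_def by blast
qed

lemma constant_remainder:
  assumes J: "ideal J (mpoly_ring n)" and var: "\<And>i. i \<in> {1..n} \<Longrightarrow> var i \<in> J"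
    and f: "f \<in> carrier (mpoly_ring n)"
  shows "\<exists>c. f - const c \<in> J"
proof -
  from f have "keys f \<subseteq> {m. keys m \<subseteq> {1..n}}"
    by (simp add: mem_carrier_iff)
  then show ?thesis
  proof (induction f rule: keys_subset_induct)
    case zero
    show ?case
      by (rule exI[of _ 0]) (simp add: const_def ideal_0[OF J])
  next
    case (single m c)
    show ?case
    proof (cases "m = 0")
      case True
      then show ?thesis
        by (intro exI[of _ c]) (simp add: const_def ideal_0[OF J])
    next
      case False
      then obtain i where i: "i \<in> keys m"
        by (metis keys_eq_empty ex_in_conv)
      define m' where "m' = m - single i 1"
      have "m = m' + single i 1"
        using i by (intro poly_mapping_eqI)
          (auto simp: m'_def lookup_add lookup_minus lookup_single when_def in_keys_iff)
      then have "single m c = single m' c * var i"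
        by (simp add: var_def Poly_Mapping.mult_single)
      moreover have "keys m' \<subseteq> keys m"
        by (auto simp: m'_def in_keys_iff lookup_minus)
      then have "single m' c \<in> carrier (mpoly_ring n)"
        using single by (auto simp: mem_carrier_iff)
      moreover have "var i \<in> J"
        using i single by (intro var) auto
      ultimately have "single m c - const 0 \<in> J"
        using ideal_mult[OF J] by (simp add: const_def)
      then show ?thesis ..
    qed
  next
    case (add g h)
    then obtain c d where "g - const c \<in> J" "h - const d \<in> J"
      by blast
    then have "(g - const c) + (h - const d) \<in> J"
      by (rule ideal_add[OF J])
    moreover have "(g - const c) + (h - const d) = (g + h) - const (c + d)"
      by (simp add: const_def Poly_Mapping.single_add)
    ultimately show ?case
      by metis
  qed
qed

text \<open>
  The relation \<open>x\<^sub>i e\<^sub>d(A) = e\<^bsub>d+1\<^esub>(A \<union> {i}) - e\<^bsub>d+1\<^esub>(A)\<close> trades a power of \<open>x\<^sub>i\<close> for one degree more in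
  the other variables, modulo the generators; after \<open>t\<close> steps the degree exceeds the number of
  variables and the polynomial is zero.
\<close>

lemma power_times_elem_mem:
  assumes J: "ideal J (mpoly_ring n)" and A: "finite A" "i \<notin> A" "i \<in> {1..n}"
    and mem: "\<And>d. Suc (card A) < d + s \<Longrightarrow> fps_nth (elem_series (insert i A)) d \<in> J"
    and "t \<le> s" "d + t = Suc (card A)"
  shows "var i ^ t * fps_nth (elem_series A) d \<in> J"
  using \<open>t \<le> s\<close> \<open>d + t = Suc (card A)\<close>
proof (induction t arbitrary: d)
  case 0
  then show ?case
    by (simp add: elem_series_nth_eq_0 A ideal_0[OF J])
next
  case (Suc t)
  have "var i ^ t * (fps_nth (elem_series (insert i A)) (Suc d) - fps_nth (elem_series A) (Suc d)) =
      var i ^ Suc t * fps_nth (elem_series A) d"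
    by (simp add: elem_series_insert_Suc A algebra_simps)
  moreover have "var i ^ t * fps_nth (elem_series (insert i A)) (Suc d) \<in> J"
    using Suc.prems by (intro ideal_mult[OF J] mem carrier_power carrier_var A) auto
  moreover have "var i ^ t * fps_nth (elem_series A) (Suc d) \<in> J"
    using Suc by simp
  ultimately show ?case
    using ideal_diff[OF J] by (metis right_diff_distrib)
qed

text \<open>
  The variables \<open>x\<^sub>1, \<dots>, x\<^sub>a\<close> are set to zero and \<open>b\<close> variables remain. Stating the result for an
  arbitrary ideal \<open>J\<close> that contains the generators makes the induction on \<open>b\<close> possible: the
  hypothesis is applied to the trailing ideals of \<open>J\<close> with respect to \<open>x\<^sub>i\<close>, \<open>i = a + 1\<close>. They contain \<open>x\<^sub>i\<close> and
  the generators in the variables after \<open>x\<^sub>i\<close>, with \<open>s\<close> replaced by \<open>s - 1\<close> for \<open>x\<^sub>i\<^sup>j\<close> with \<open>j < s\<close>, and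
  with the same \<open>s\<close> from \<open>j = s\<close> on.
\<close>

lemma spanning_monomials:
  assumes "ideal J (mpoly_ring n)" "1 \<le> k" "a + b = n" "s \<le> k"
    and "\<And>i. i \<in> {1..a} \<Longrightarrow> var i \<in> J"
    and "\<And>l. l \<in> {Suc a..n} \<Longrightarrow> fps_nth (hl_series {Suc a..l}) k \<in> J"
    and "\<And>d. b < d + s \<Longrightarrow> fps_nth (elem_series {Suc a..n}) d \<in> J"
  shows "\<exists>M. finite M \<and> card M \<le> cover_number k b s \<and>
    (\<forall>f\<in>carrier (mpoly_ring n). \<exists>p\<in>carrier (mpoly_ring n). keys p \<subseteq> M \<and> f - p \<in> J)"
  using assms
proof (induction b arbitrary: a s J)
  case (0 a s J)
  note J = \<open>ideal J (mpoly_ring n)\<close>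
  show ?case
  proof (cases "s = 0")
    case True
    have "\<exists>p\<in>carrier (mpoly_ring n). keys p \<subseteq> {0} \<and> f - p \<in> J" if f: "f \<in> carrier (mpoly_ring n)" for f
    proof -
      obtain c where "f - const c \<in> J"
        using constant_remainder[of J n f] 0 f by auto
      moreover have "keys (const c) \<subseteq> {0}"
        by (simp add: const_def)
      ultimately show ?thesis
        using carrier_const by blast
    qed
    then show ?thesis
      using True by (intro exI[of _ "{0}"]) simp
  next
    case False
    then have "fps_nth (elem_series {Suc a..n}) 0 \<in> J"
      using 0 by simp
    then have "1 \<in> J"
      by (simp add: elem_series_nth_0)
    then have "f - 0 \<in> J" if "f \<in> carrier (mpoly_ring n)" for f
      using ideal_mult[OF J that \<open>1 \<in> J\<close>] by simp
    then show ?thesis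
      using carrier_0 by (intro exI[of _ "{}"]) fastforce
  qed
next
  case (Suc b a s J)
  note J = \<open>ideal J (mpoly_ring n)\<close>
  define i where "i = Suc a"
  define A where "A = {Suc i..n}"
  have i: "i \<in> {1..n}" "i + b = n"
    using Suc.prems by (auto simp: i_def)
  have ins: "{Suc a..l} = insert i {Suc i..l}" if "i \<le> l" for l
    using that by (auto simp: i_def)
  have A: "finite A" "i \<notin> A" "card A = b" "{Suc a..n} = insert i A" "A \<subseteq> {1..n}"
    using i by (auto simp: A_def i_def)
  let ?x = "var i :: F mpoly"
  have x: "?x \<in> carrier (mpoly_ring n)"
    by (rule carrier_var[OF i(1)])
  let ?J = "trailing_ideal n J ?x"
  have elem_carrier: "fps_nth (elem_series A) d \<in> carrier (mpoly_ring n)" for d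
    using graded_elem_series[OF A(5)] by (simp add: graded_def)
  have var: "var l \<in> ?J j" if l: "l \<in> {1..i}" for l j
  proof (cases "l = i")
    case True
    \<comment> \<open>\<open>x\<^sub>i\<close> is divisible by \<open>x\<^sub>i\<close>, so it is a trailing coefficient with correction term \<open>1\<close>.\<close>
    have "?x ^ j * ?x - ?x ^ Suc j * 1 \<in> J"
      using ideal_0[OF J] by (simp add: mult.commute)
    then show ?thesis
      unfolding trailing_ideal_def using x True carrier_1 by blast
  next
    case False
    with l have "l \<in> {1..a}"
      by (auto simp: i_def)
    then have "var l \<in> J"
      using Suc.prems by blast
    then show ?thesis
      using ideal_carrier[OF J] ideal_mult[OF J carrier_power[OF x]] by (blast intro: trailing_idealI)
  qed
  have hl: "fps_nth (hl_series {Suc i..l}) k \<in> ?J j" if l: "l \<in> {Suc i..n}" for l j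
  proof -
    have sub: "insert i {Suc i..l} \<subseteq> {1..n}"
      using l i by auto
    then obtain g where g: "g \<in> carrier (mpoly_ring n)"
      "fps_nth (hl_series (insert i {Suc i..l})) k = fps_nth (hl_series {Suc i..l}) k + ?x * g"
      using hl_series_insert[of "{Suc i..l}" i n k] by auto
    have "fps_nth (hl_series {Suc a..l}) k \<in> J"
      using Suc.prems l by (auto simp: i_def)
    then have "fps_nth (hl_series {Suc i..l}) k + ?x * g \<in> J"
      using g(2) ins[of l] l by simp
    moreover have "fps_nth (hl_series {Suc i..l}) k \<in> carrier (mpoly_ring n)"
      using graded_hl_series[of "{Suc i..l}" n] sub by (simp add: graded_def)
    ultimately show ?thesis
      using trailing_idealI_mod[OF J x _ _ g(1)] by blast
  qed
  have elem: "fps_nth (elem_series A) d \<in> ?J j" if d: "Suc b < d + s" for d j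
  proof (cases d)
    case 0
    have "fps_nth (elem_series A) d \<in> J"
      using Suc.prems(7)[of d] d by (simp add: 0 elem_series_nth_0)
    then show ?thesis
      by (intro trailing_idealI[OF elem_carrier] ideal_mult[OF J] carrier_power[OF x])
  next
    case (Suc d')
    have "fps_nth (elem_series (insert i A)) d \<in> J"
      using Suc.prems(7)[of d] d A(4) by simp
    then have "fps_nth (elem_series A) d + ?x * fps_nth (elem_series A) d' \<in> J"
      by (simp add: Suc elem_series_insert_Suc A)
    then show ?thesis
      by (rule trailing_idealI_mod[OF J x _ elem_carrier elem_carrier])
  qed
  have elem': "fps_nth (elem_series A) d \<in> ?J j" if d: "b < d + s" and j: "s \<le> j" for d j
  proof (cases "Suc b < d + s")
    case False
    then have "d + s = Suc (card A)"
      using d A(3) by simp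
    then have "?x ^ s * fps_nth (elem_series A) d \<in> J"
      using Suc.prems(7) A i(1) by (intro power_times_elem_mem[OF J, where s = s]) auto
    then have "?x ^ (j - s) * (?x ^ s * fps_nth (elem_series A) d) \<in> J"
      by (rule ideal_mult[OF J carrier_power[OF x]])
    then have "?x ^ j * fps_nth (elem_series A) d \<in> J"
      using j by (simp only: mult.assoc[symmetric] power_add[symmetric] le_add_diff_inverse2)
    then show ?thesis
      by (rule trailing_idealI[OF elem_carrier])
  qed (rule elem)
  have "\<exists>M. finite M \<and> card M \<le> cover_number k b (if j < s then s - 1 else s) \<and>
    (\<forall>f\<in>carrier (mpoly_ring n). \<exists>p\<in>carrier (mpoly_ring n). keys p \<subseteq> M \<and> f - p \<in> ?J j)" for j
  proof (rule Suc.IH[OF trailing_ideal_ideal[OF J] \<open>1 \<le> k\<close> i(2)])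
    show "fps_nth (elem_series {Suc i..n}) d \<in> ?J j" if "b < d + (if j < s then s - 1 else s)" for d
      using that elem[of d j] elem'[of d j] unfolding A_def[symmetric] by (auto split: if_splits)
  qed (use var hl Suc.prems in auto)
  then obtain M where M: "\<And>j. finite (M j)"
    "\<And>j. card (M j) \<le> cover_number k b (if j < s then s - 1 else s)"
    "\<And>j f. f \<in> carrier (mpoly_ring n) \<Longrightarrow>
      \<exists>p\<in>carrier (mpoly_ring n). keys p \<subseteq> M j \<and> f - p \<in> ?J j"
    by metis
  \<comment> \<open>Layer \<open>j\<close> contributes the monomials of \<open>M j\<close> times \<open>x\<^sub>i\<^sup>j\<close>.\<close>
  define U where "U = (\<Union>j<k. (+) (single i j) ` M j)"
  have "finite U"
    using M(1) by (simp add: U_def)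
  moreover have "card U \<le> cover_number k (Suc b) s"
  proof -
    have "card U \<le> (\<Sum>j<k. card ((+) (single i j) ` M j))"
      unfolding U_def by (rule card_UN_le) simp
    also have "\<dots> \<le> (\<Sum>j<k. cover_number k b (if j < s then s - 1 else s))"
      by (intro sum_mono le_trans[OF card_image_le M(2)] M(1))
    also have "{..<k} = {..<s} \<union> {s..<k}"
      using \<open>s \<le> k\<close> by auto
    also have "(\<Sum>j\<in>\<dots>. cover_number k b (if j < s then s - 1 else s)) =
        (\<Sum>j<s. cover_number k b (s - 1)) + (\<Sum>j\<in>{s..<k}. cover_number k b s)"
      by (subst sum.union_disjoint) (auto intro!: arg_cong2[of _ _ _ _ "(+)"] sum.cong)
    finally show ?thesis
      by simp
  qed
  moreover have "\<exists>p\<in>carrier (mpoly_ring n). keys p \<subseteq> U \<and> f - p \<in> J"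
    if f: "f \<in> carrier (mpoly_ring n)" for f
  proof -
    \<comment> \<open>Clear one layer after the other, until the remainder is a multiple of \<open>x\<^sub>i\<^sup>k\<close>.\<close>
    have "\<exists>p\<in>carrier (mpoly_ring n). \<exists>g\<in>carrier (mpoly_ring n). keys p \<subseteq> U \<and> f - p - ?x ^ t * g \<in> J"
      if "t \<le> k" for t
      using that
    proof (induction t)
      case 0
      show ?case
        using f ideal_0[OF J] by (intro bexI[of _ 0] bexI[of _ f] carrier_0) simp_all
    next
      case (Suc t)
      then obtain p g where p: "p \<in> carrier (mpoly_ring n)" "keys p \<subseteq> U"
        and g: "g \<in> carrier (mpoly_ring n)" "f - p - ?x ^ t * g \<in> J"
        by auto
      obtain p' where p': "p' \<in> carrier (mpoly_ring n)" "keys p' \<subseteq> M t" "g - p' \<in> ?J t"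
        using M(3)[OF g(1)] by blast
      then obtain g' where g': "g' \<in> carrier (mpoly_ring n)" "?x ^ t * (g - p') - ?x ^ Suc t * g' \<in> J"
        unfolding trailing_ideal_def by blast
      have power: "?x ^ t = single (single i t) 1"
        by (induction t) (simp_all add: var_def Poly_Mapping.mult_single Poly_Mapping.single_add[symmetric])
      have "keys (?x ^ t * p') \<subseteq> (+) (single i t) ` M t"
        using Poly_Mapping.keys_mult[of "?x ^ t" p'] p'(2) unfolding power by (auto split: if_splits)
      also have "\<dots> \<subseteq> U"
        using Suc.prems unfolding U_def by (intro UN_upper) simp
      finally have "keys (p + ?x ^ t * p') \<subseteq> U"
        using Poly_Mapping.keys_add[of p "?x ^ t * p'"] p(2) by blast
      moreover have eq: "f - (p + ?x ^ t * p') - ?x ^ Suc t * g' =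
          (f - p - ?x ^ t * g) + (?x ^ t * (g - p') - ?x ^ Suc t * g')"
        by (simp add: algebra_simps)
      have "f - (p + ?x ^ t * p') - ?x ^ Suc t * g' \<in> J"
        unfolding eq by (rule ideal_add[OF J g(2) g'(2)])
      moreover have "p + ?x ^ t * p' \<in> carrier (mpoly_ring n)"
        using p(1) p'(1) x by (intro carrier_add carrier_mult carrier_power)
      ultimately show ?case
        using g'(1) by blast
    qed
    from this[of k] obtain p g where p: "p \<in> carrier (mpoly_ring n)" "keys p \<subseteq> U"
      and g: "g \<in> carrier (mpoly_ring n)" "f - p - ?x ^ k * g \<in> J"
      by auto
    \<comment> \<open>The Hall-Littlewood polynomial in the single variable \<open>x\<^sub>i\<close> is \<open>x\<^sub>i\<^sup>k\<close>, so that remainder is in \<open>J\<close>.\<close>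
    have "fps_nth (hl_series {i}) k \<in> J"
      using Suc.prems(6)[of i] i by (simp add: i_def)
    then have "const (1 - q) * ?x ^ k \<in> J"
      using \<open>1 \<le> k\<close> by (simp add: hl_series_singleton)
    then have "const (1 / (1 - q)) * (const (1 - q) * ?x ^ k) \<in> J"
      by (rule ideal_mult[OF J carrier_const])
    moreover have "const (1 / (1 - q)) * const (1 - q) = 1"
      using q_neq_1 by (simp add: const_mult const_1)
    ultimately have "?x ^ k \<in> J"
      by (simp add: mult.assoc[symmetric])
    then have "(f - p - ?x ^ k * g) + ?x ^ k * g \<in> J"
      using ideal_add[OF J g(2) ideal_mult_right[OF J g(1)]] by blast
    then show ?thesis
      using p by auto
  qed
  ultimately show ?case
    by blast
qed


section \<open>The number of points\<close>

lemma finite_PiE_cover: "finite D \<Longrightarrow> finite K \<Longrightarrow> finite {g \<in> D \<rightarrow>\<^sub>E K. A \<subseteq> g ` D}"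
  by (simp add: finite_PiE)

text \<open>
  Maps on \<open>insert x D\<close> that cover \<open>A\<close> are obtained by choosing the value \<open>r\<close> at \<open>x\<close> and a map on \<open>D\<close>
  that covers \<open>A - {r}\<close>.
\<close>

lemma cover_number_le_card:
  assumes "finite D" "finite K" "A \<subseteq> K"
  shows "cover_number (card K) (card D) (card A) \<le> card {g \<in> D \<rightarrow>\<^sub>E K. A \<subseteq> g ` D}"
  using assms(1,3)
proof (induction D arbitrary: A)
  case (empty A)
  have "finite A"
    using finite_subset[OF empty.prems assms(2)] .
  then show ?case
    by (cases "A = {}") auto
next
  case (insert x D A)
  let ?C = "\<lambda>D A. {g \<in> D \<rightarrow>\<^sub>E K. A \<subseteq> g ` D}"
  have finA: "finite A"
    using finite_subset[OF insert.prems assms(2)] .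
  let ?h = "\<lambda>(r, g). g(x := r)"
  have inj: "inj_on ?h (Sigma K (\<lambda>r. ?C D (A - {r})))"
  proof (rule inj_onI, clarify)
    fix r g r' g'
    assume g: "g \<in> D \<rightarrow>\<^sub>E K" "g' \<in> D \<rightarrow>\<^sub>E K" and eq: "g(x := r) = g'(x := r')"
    have "r = r'"
      using fun_cong[OF eq, of x] by simp
    moreover have "g z = g' z" for z
      using fun_cong[OF eq, of z] g insert.hyps(2) by (cases "z = x") (auto simp: PiE_def extensional_def)
    ultimately show "r = r' \<and> g = g'"
      by blast
  qed
  have maps: "?h ` Sigma K (\<lambda>r. ?C D (A - {r})) \<subseteq> ?C (insert x D) A"
  proof clarify
    fix r g assume r: "r \<in> K" and g: "g \<in> D \<rightarrow>\<^sub>E K" "A - {r} \<subseteq> g ` D"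
    have "g(x := r) ` insert x D = insert r (g ` D)"
      using insert.hyps(2) by auto
    then have "A \<subseteq> g(x := r) ` insert x D"
      using g(2) by blast
    moreover have "g(x := r) \<in> insert x D \<rightarrow>\<^sub>E K"
      using g(1) r
      by (auto simp: PiE_def extensional_def)
    ultimately show "g(x := r) \<in> insert x D \<rightarrow>\<^sub>E K \<and> A \<subseteq> g(x := r) ` insert x D"
      by blast
  qed
  have "cover_number (card K) (card (insert x D)) (card A) =
      (\<Sum>r\<in>A. cover_number (card K) (card D) (card (A - {r}))) +
      (\<Sum>r\<in>K - A. cover_number (card K) (card D) (card (A - {r})))"
    using insert.hyps finA insert.prems by (simp add: card_Diff_subset)
  also have "\<dots> = (\<Sum>r\<in>K. cover_number (card K) (card D) (card (A - {r})))"
    unfolding sum.subset_diff[OF insert.prems assms(2)] by (rule add.commute)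
  also have "\<dots> \<le> (\<Sum>r\<in>K. card (?C D (A - {r})))"
    using insert.prems by (intro sum_mono insert.IH) auto
  also have "\<dots> = card (Sigma K (\<lambda>r. ?C D (A - {r})))"
    using finite_PiE_cover[OF insert.hyps(1) assms(2)] by (subst card_SigmaI) (auto simp: assms(2))
  also have "\<dots> \<le> card (?C (insert x D) A)"
    using insert.hyps(1) assms(2) by (intro card_inj_on_le[OF inj maps] finite_PiE_cover) auto
  finally show ?case .
qed

text \<open>
  The point of an ordered set partition with blocks \<open>g -` {r}\<close>: the exponent of \<open>q\<close> counts the
  earlier members of the block of \<open>i\<close>.
\<close>

definition block_point :: "nat \<Rightarrow> (nat \<Rightarrow> rat) \<Rightarrow> (nat \<Rightarrow> nat) \<Rightarrow> nat \<Rightarrow> F" where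
  "block_point n \<alpha> g = (\<lambda>i\<in>{1..n}. q ^ card {i'\<in>{1..<i}. g i' = g i} * of_rat (\<alpha> (g i)))"

lemma block_point_eq_iff:
  assumes \<alpha>: "inj_on \<alpha> {1..k}" "\<forall>r\<in>{1..k}. \<alpha> r \<noteq> 0"
    and g: "g \<in> {1..n} \<rightarrow>\<^sub>E {1..k}" and i: "i \<in> {1..n}" and r: "r \<in> {1..k}"
  shows "block_point n \<alpha> g i = q ^ j * of_rat (\<alpha> r) \<longleftrightarrow> g i = r \<and> card {i'\<in>{1..<i}. g i' = r} = j"
proof -
  have gi: "g i \<in> {1..k}"
    using g i by auto
  then have "\<alpha> (g i) = \<alpha> r \<longleftrightarrow> g i = r"
    using inj_on_eq_iff[OF \<alpha>(1)] r by blast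
  then show ?thesis
    using q_power_mult_of_rat_eq_iff[of "\<alpha> (g i)" "\<alpha> r"] \<alpha>(2) gi r i
    by (auto simp: block_point_def)
qed

lemma card_predecessors_less:
  fixes P :: "nat \<Rightarrow> bool"
  assumes "1 \<le> i" "i < l" "P i"
  shows "card {i'\<in>{1..<i}. P i'} < card {i'\<in>{1..<l}. P i'}"
  by (rule psubset_card_mono) (use assms in auto)

text \<open>
  Within a block the exponents are \<open>0, 1, 2, \<dots>\<close> in increasing order of position; the least member of
  block \<open>r\<close> has coordinate \<open>\<alpha>\<^sub>r\<close>, and the previous member of the block supplies the predecessor that
  a positive exponent demands.
\<close>

lemma block_point_in_point_set:
  assumes \<alpha>: "inj_on \<alpha> {1..k}" "\<forall>r\<in>{1..k}. \<alpha> r \<noteq> 0"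
    and g: "g \<in> {1..n} \<rightarrow>\<^sub>E {1..k}" and cover: "{1..k} \<subseteq> g ` {1..n}"
  shows "block_point n \<alpha> g \<in> point_set n k \<alpha>"
proof -
  let ?y = "block_point n \<alpha> g"
  let ?c = "\<lambda>i r. card {i'\<in>{1..<i}. g i' = r}"
  note eq_iff = block_point_eq_iff[OF \<alpha> g]
  have gi: "g i \<in> {1..k}" if "i \<in> {1..n}" for i
    using g that by auto
  have y: "?y i = q ^ ?c i (g i) * of_rat (\<alpha> (g i))" if "i \<in> {1..n}" for i
    using eq_iff[OF that gi[OF that]] by blast
  have "?y \<in> {1..n} \<rightarrow>\<^sub>E UNIV"
    by (auto simp: block_point_def)
  moreover have "\<forall>i\<in>{1..n}. ?y i \<in> {q ^ j * of_rat (\<alpha> r) | j r. r \<in> {1..k}}"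
    using y gi by blast
  moreover have "inj_on ?y {1..n}"
  proof (rule inj_onI)
    fix i l assume i: "i \<in> {1..n}" and l: "l \<in> {1..n}" and "?y i = ?y l"
    then have "g i = g l" "?c i (g l) = ?c l (g l)"
      using eq_iff[OF i gi[OF l]] y[OF l] by auto
    then show "i = l"
      using card_predecessors_less[of i l "\<lambda>i'. g i' = g l"] card_predecessors_less[of l i "\<lambda>i'. g i' = g l"] i l
      by (metis atLeastAtMost_iff less_irrefl nat_neq_iff)
  qed
  moreover have "of_rat (\<alpha> r) \<in> ?y ` {1..n}" if r: "r \<in> {1..k}" for r
  proof -
    obtain i where i: "i \<in> {1..n}" "g i = r"
      using cover r by blast
    define i0 where "i0 = (LEAST i. i \<in> {1..n} \<and> g i = r)"
    have i0: "i0 \<in> {1..n}" "g i0 = r"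
      using LeastI[of "\<lambda>i. i \<in> {1..n} \<and> g i = r" i] i unfolding i0_def by auto
    have "g i' \<noteq> r" if "i' \<in> {1..<i0}" for i'
    proof -
      have "\<not> (i' \<in> {1..n} \<and> g i' = r)"
        using that not_less_Least[of i' "\<lambda>i. i \<in> {1..n} \<and> g i = r"] unfolding i0_def[symmetric] by simp
      then show ?thesis
        using that i0(1) by auto
    qed
    then have "{i'\<in>{1..<i0}. g i' = r} = {}"
      by blast
    then have "?y i0 = q ^ 0 * of_rat (\<alpha> r)"
      using eq_iff[OF i0(1) r, of 0] i0(2) by simp
    then show ?thesis
      using i0(1) by (metis image_eqI mult_1 power_0)
  qed
  moreover have "\<exists>i'\<in>{1..<i}. ?y i' = q ^ (j - 1) * of_rat (\<alpha> r)"
    if i: "i \<in> {1..n}" and j: "j > 0" and r: "r \<in> {1..k}" and yi: "?y i = q ^ j * of_rat (\<alpha> r)" for i j r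
  proof -
    let ?S = "{i'\<in>{1..<i}. g i' = r}"
    have c: "card ?S = j"
      using yi eq_iff[OF i r] by blast
    then have "?S \<noteq> {}"
      using j by (metis card.empty less_irrefl)
    define m where "m = Max ?S"
    have "m \<in> ?S"
      unfolding m_def by (rule Max_in) (use \<open>?S \<noteq> {}\<close> in auto)
    then have m: "m \<in> {1..<i}" "g m = r"
      by auto
    have "i' \<le> m" if "i' \<in> ?S" for i'
      unfolding m_def by (rule Max_ge) (use that in auto)
    then have "?S = insert m {i'\<in>{1..<m}. g i' = r}"
      using m by (auto simp: order.order_iff_strict)
    then have "j = Suc (card {i'\<in>{1..<m}. g i' = r})"
      using c by simp
    then have "?y m = q ^ (j - 1) * of_rat (\<alpha> r)"
      using eq_iff[of m r "j - 1"] m i r by auto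
    then show ?thesis
      using m(1) by blast
  qed
  ultimately show ?thesis
    unfolding point_set_def by blast
qed

lemma point_set_large:
  assumes \<alpha>: "inj_on \<alpha> {1..k}" "\<forall>r\<in>{1..k}. \<alpha> r \<noteq> 0"
  shows "\<exists>Y. finite Y \<and> Y \<subseteq> point_set n k \<alpha> \<and> cover_number k n k \<le> card Y"
proof -
  let ?G = "{g \<in> {1..n} \<rightarrow>\<^sub>E {1..k}. {1..k} \<subseteq> g ` {1..n}}"
  have "inj_on (block_point n \<alpha>) ?G"
  proof (rule inj_onI)
    fix g h assume g: "g \<in> ?G" and h: "h \<in> ?G" and eq: "block_point n \<alpha> g = block_point n \<alpha> h"
    have "g i = h i" if i: "i \<in> {1..n}" for i
    proof -
      have hi: "h i \<in> {1..k}"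
        using h i by auto
      have "block_point n \<alpha> h i = q ^ card {i'\<in>{1..<i}. h i' = h i} * of_rat (\<alpha> (h i))"
        using block_point_eq_iff[OF \<alpha> _ i hi] h by blast
      then show ?thesis
        using block_point_eq_iff[OF \<alpha> _ i hi, of g] g eq by auto
    qed
    then show "g = h"
      using g h by (intro PiE_ext[of g "{1..n}" "\<lambda>_. {1..k}" h]) auto
  qed
  then have "card (block_point n \<alpha> ` ?G) = card ?G"
    by (rule card_image)
  moreover have "cover_number k n k \<le> card ?G"
    using cover_number_le_card[of "{1..n}" "{1..k}" "{1..k}"] by simp
  moreover have "finite ?G"
    by (rule finite_PiE_cover) auto
  ultimately show ?thesis
    using block_point_in_point_set[OF \<alpha>] by (intro exI[of _ "block_point n \<alpha> ` ?G"]) auto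
qed


section \<open>Comparison of the two ideals\<close>

lemma lookup_const_mult: "lookup (const c * f) m = c * lookup f m"
  by (induction f rule: keys_subset_induct[OF subset_UNIV, case_names zero single add])
    (auto simp: const_def Poly_Mapping.mult_single lookup_single when_def lookup_add algebra_simps)

text \<open>
  Lagrange interpolation: for each other point \<open>z\<close> pick a coordinate in which \<open>z\<close> and \<open>y\<close> differ.
\<close>

lemma separating_polynomial:
  fixes Y :: "(nat \<Rightarrow> 'a::field) set"
  assumes "finite Y" "Y \<subseteq> {1..n} \<rightarrow>\<^sub>E UNIV" "y \<in> Y"
  shows "\<exists>f\<in>carrier (mpoly_ring n). \<forall>z\<in>Y. eval z f = (if z = y then 1 else 0)"
proof -
  have "\<exists>i\<in>{1..n}. y i \<noteq> z i" if "z \<in> Y - {y}" for z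
    using that assms(2,3) PiE_ext[of y "{1..n}" "\<lambda>_. UNIV" z] by blast
  then obtain i where i: "\<And>z. z \<in> Y - {y} \<Longrightarrow> i z \<in> {1..n} \<and> y (i z) \<noteq> z (i z)"
    by metis
  define f where "f = (\<Prod>z\<in>Y - {y}. const (1 / (y (i z) - z (i z))) * (var (i z) - const (z (i z))))"
  have "f \<in> carrier (mpoly_ring n)"
    unfolding f_def using i by (intro carrier_intros) auto
  moreover have "eval y f = 1"
    unfolding f_def eval_prod by (rule prod.neutral) (use i in auto)
  moreover have "eval z f = 0" if "z \<in> Y" "z \<noteq> y" for z
    unfolding f_def eval_prod using that assms(1) by (intro prod_zero) auto
  ultimately show ?thesis
    by (intro bexI[of _ f]) auto
qed

text \<open>
  If \<open>p \<noteq> 0\<close>, then \<open>p\<close> and the polynomials that separate the points of \<open>Y\<close> are linearly independent, as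
  evaluation at the points shows. They are \<open>card Y + 1\<close> vectors in the span of the \<open>card M\<close>
  monomials of \<open>M\<close>, which is too many.
\<close>

lemma vanishing_eq_0:
  fixes p :: "F mpoly"
  assumes M: "finite M" and Y: "finite Y" "card M \<le> card Y"
    and sep: "\<And>y. y \<in> Y \<Longrightarrow> \<exists>f. keys f \<subseteq> M \<and> (\<forall>z\<in>Y. eval z f = (if z = y then 1 else 0))"
    and p: "keys p \<subseteq> M" "\<And>y. y \<in> Y \<Longrightarrow> eval y p = 0"
  shows "p = 0"
proof (rule ccontr)
  assume "p \<noteq> 0"
  interpret vector_space "\<lambda>c (f :: F mpoly). const c * f"
    by unfold_locales
      (simp_all add: const_def const_1[unfolded const_def] Poly_Mapping.mult_single
        Poly_Mapping.single_add algebra_simps mult.assoc[symmetric])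
  obtain P where P: "\<And>y. y \<in> Y \<Longrightarrow> keys (P y) \<subseteq> M"
    "\<And>y z. y \<in> Y \<Longrightarrow> z \<in> Y \<Longrightarrow> eval z (P y) = (if z = y then 1 else 0)"
    using sep by metis
  have inj: "inj_on P Y"
  proof (rule inj_onI)
    fix y z assume yz: "y \<in> Y" "z \<in> Y" and "P y = P z"
    then have "eval y (P y) = eval y (P z)"
      by simp
    then show "y = z"
      using P(2) yz by (metis zero_neq_one)
  qed
  have notin: "p \<notin> P ` Y"
  proof
    assume "p \<in> P ` Y"
    then obtain y where "y \<in> Y" "p = P y"
      by blast
    then show False
      using P(2)[of y y] p(2)[of y] by simp
  qed
  let ?S = "insert p (P ` Y)"
  have "independent ?S"
  proof
    assume "dependent ?S"
    then obtain u where u: "\<exists>v\<in>?S. u v \<noteq> 0" and sum: "(\<Sum>v\<in>?S. const (u v) * v) = 0"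
      using dependent_finite[of ?S] Y(1) by auto
    have split: "(\<Sum>v\<in>?S. const (u v) * v) = const (u p) * p + (\<Sum>z\<in>Y. const (u (P z)) * P z)"
      using Y(1) notin by (simp add: sum.reindex[OF inj])
    have uP: "u (P y) = 0" if "y \<in> Y" for y
    proof -
      have "0 = eval y (\<Sum>v\<in>?S. const (u v) * v)"
        by (simp only: sum eval_0)
      also have "\<dots> = (\<Sum>z\<in>Y. u (P z) * eval y (P z))"
        unfolding split using p(2)[OF that] by simp
      also have "\<dots> = (\<Sum>z\<in>Y. if z = y then u (P z) else 0)"
        by (rule sum.cong) (use P(2)[OF _ that] in auto)
      also have "\<dots> = u (P y)"
        using that Y(1) by simp
      finally show ?thesis
        by simp
    qed
    then have zero: "const (u p) * p = 0"
      using sum unfolding split by (simp add: const_def)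
    obtain m where "lookup p m \<noteq> 0"
      using \<open>p \<noteq> 0\<close> by (metis poly_mapping_eqI lookup_zero)
    moreover have "u p * lookup p m = 0"
      by (simp only: lookup_const_mult[symmetric] zero lookup_zero)
    ultimately have "u p = 0"
      by simp
    then show False
      using u uP by blast
  qed
  moreover have "?S \<subseteq> span ((\<lambda>m. single m 1) ` M)"
  proof
    fix f assume "f \<in> ?S"
    then have "keys f \<subseteq> M"
      using P(1) p(1) by auto
    then show "f \<in> span ((\<lambda>m. single m 1) ` M)"
    proof (induction f rule: keys_subset_induct)
      case zero
      show ?case by (rule span_zero)
    next
      case (single m c)
      then have "const c * single m 1 \<in> span ((\<lambda>m. single m 1) ` M)"
        by (intro span_scale span_base) blast
      then show ?case
        by (simp add: const_def Poly_Mapping.mult_single)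
    next
      case (add g h)
      then show ?case by (intro span_add)
    qed
  qed
  ultimately have "card ?S \<le> card ((\<lambda>m. single m (1 :: F)) ` M)"
    using independent_span_bound[of "(\<lambda>m. single m 1) ` M" ?S] M by blast
  also have "\<dots> \<le> card Y"
    using card_image_le[OF M] Y(2) by (rule order_trans)
  also have "\<dots> < card ?S"
    using Y(1) notin card_image[OF inj] by simp
  finally show False
    by simp
qed

text \<open>
  Division from the top degree down. The top component of \<open>f\<close> is a combination of \<open>M\<close> plus a form
  in \<open>I\<close>; that form is the leading form of some \<open>v \<in> V\<close>, and subtracting \<open>v\<close> lowers the degree. The
  final conjunct records the form in \<open>I\<close> from the first step; the hypothesis on \<open>f\<close> bounds its
  degree by \<open>d - 1\<close>.
\<close>

lemma reduction_modulo_vanishing: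
  assumes V: "ideal V (mpoly_ring n)" and I: "ideal I (mpoly_ring n)"
    and lead: "\<And>h d. h \<in> I \<Longrightarrow> component d h \<in> I \<and> leading_form_in V d (component d h)"
    and span: "\<And>f. f \<in> carrier (mpoly_ring n) \<Longrightarrow>
      \<exists>p\<in>carrier (mpoly_ring n). keys p \<subseteq> M \<and> f - p \<in> I"
    and f: "f \<in> carrier (mpoly_ring n)" "\<And>e. e \<ge> d \<Longrightarrow> component e f = 0"
  shows "\<exists>p\<in>carrier (mpoly_ring n). keys p \<subseteq> M \<and> f - p \<in> V \<and> (\<forall>e\<ge>d. component e p = 0) \<and>
    component (d - 1) (f - p) \<in> I"
  using f
proof (induction d arbitrary: f)
  case (0 f)
  have "f = 0"
    by (rule component_eqI) (simp add: 0)
  then show ?case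
    using ideal_0[OF V] ideal_0[OF I] carrier_0 by (intro bexI[of _ 0]) simp_all
next
  case (Suc d f)
  obtain p where p: "p \<in> carrier (mpoly_ring n)" "keys p \<subseteq> M" "f - p \<in> I"
    using span[OF Suc.prems(1)] by blast
  let ?g = "component d (f - p)"
  have "?g \<in> I"
    using lead[OF p(3)] by blast
  obtain v where v: "v \<in> V" "\<And>e. e \<ge> d \<Longrightarrow> component e v = (if e = d then ?g else 0)"
    using lead[OF p(3), of d] unfolding leading_form_in_def by blast
  let ?f = "f - component d p - v"
  have "?f \<in> carrier (mpoly_ring n)"
    using Suc.prems(1) p(1) ideal_carrier[OF V v(1)] by (intro carrier_diff component_carrier)
  moreover have "component e ?f = 0" if "e \<ge> d" for e
    using Suc.prems(2)[of e] v(2)[OF that] that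
    by (cases "e = d") (simp_all add: component_diff component_component)
  ultimately obtain p' where p': "p' \<in> carrier (mpoly_ring n)" "keys p' \<subseteq> M" "?f - p' \<in> V"
    "\<And>e. e \<ge> d \<Longrightarrow> component e p' = 0"
    using Suc.IH by blast
  let ?p = "component d p + p'"
  have "?p \<in> carrier (mpoly_ring n)"
    using p(1) p'(1) by (intro carrier_add component_carrier)
  moreover have "keys ?p \<subseteq> M"
    using Poly_Mapping.keys_add[of "component d p" p'] p(2) p'(2) by (auto simp: keys_component)
  moreover have eq: "f - ?p = (?f - p') + v"
    by (simp add: algebra_simps)
  have "f - ?p \<in> V"
    unfolding eq by (rule ideal_add[OF V p'(3) v(1)])
  moreover have "component e ?p = 0" if "e \<ge> Suc d" for e
    using that p'(4) by (simp add: component_add component_component)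
  moreover have "component d (f - ?p) = ?g"
    using p'(4) by (simp add: component_diff component_add component_component)
  ultimately show ?case
    using \<open>?g \<in> I\<close> by (intro bexI[of _ ?p]) simp_all
qed

lemma top_component_eq: "top_component f = component (total_degree f) f"
  by (simp add: top_component_def component_def)

lemma component_above_total_degree:
  assumes "e > total_degree f"
  shows "component e f = 0"
proof -
  have "mon_degree m \<le> total_degree f" if "m \<in> keys f" for m
    unfolding total_degree_def by (rule Max_ge) (use that in auto)
  then have "m \<notin> keys (component e f)" for m
    using assms unfolding keys_component by force
  then have "keys (component e f) = {}"
    by blast
  then show ?thesis
    by simp
qed

lemma leading_form_top_component:
  assumes "leading_form_in V d h" "h \<noteq> 0"
  shows "h \<in> top_component ` (V - {0})"
proof -
  obtain v where v: "v \<in> V" "\<And>e. e \<ge> d \<Longrightarrow> component e v = (if e = d then h else 0)"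
    using assms(1) unfolding leading_form_in_def by blast
  have "keys (component d v) \<noteq> {}"
    using v(2)[of d] assms(2) by simp
  then obtain m where m: "m \<in> keys v" "mon_degree m = d"
    by (auto simp: keys_component)
  have "mon_degree m' \<le> d" if "m' \<in> keys v" for m'
  proof (rule ccontr)
    assume "\<not> mon_degree m' \<le> d"
    then have "component (mon_degree m') v = 0"
      using v(2) by simp
    moreover have "m' \<in> keys (component (mon_degree m') v)"
      using that by (simp add: keys_component)
    ultimately show False
      by simp
  qed
  then have "total_degree v = d"
    unfolding total_degree_def using m by (intro Max_eqI) auto
  then have "top_component v = h"
    using v(2)[of d] by (simp add: top_component_eq)
  moreover have "v \<noteq> 0"
    using m(1) by auto
  ultimately show ?thesis
    using v(1) by blast
qed

lemma leading_form_const_mult: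
  assumes "ideal V (mpoly_ring n)" "leading_form_in V d h"
  shows "leading_form_in V d (const c * h)"
proof -
  obtain v where v: "v \<in> V" "\<And>e. e \<ge> d \<Longrightarrow> component e v = (if e = d then h else 0)"
    using assms(2) unfolding leading_form_in_def by blast
  have "const c * v \<in> V"
    by (rule ideal_mult[OF assms(1) carrier_const v(1)])
  moreover have "component e (const c * v) = (if e = d then const c * h else 0)" if "e \<ge> d" for e
    using v(2)[OF that] by (simp add: const_def component_single_mult)
  ultimately show ?thesis
    unfolding leading_form_in_def by blast
qed

lemma generators_leading_forms:
  assumes "1 \<le> k" "inj_on \<alpha> {1..k}" "\<forall>r\<in>{1..k}. \<alpha> r \<noteq> 0"
    and "h \<in> hall_littlewood k ` {1..n} \<union> (\<lambda>d. elem_sym d n) ` {n - k + 1..n}"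
  shows "\<exists>d. homogeneous d h \<and> h \<in> carrier (mpoly_ring n) \<and>
    leading_form_in (vanishing_ideal n (point_set n k \<alpha>)) d h"
  using assms(4)
proof
  assume "h \<in> hall_littlewood k ` {1..n}"
  then obtain i where i: "i \<in> {1..n}" and h: "h = const (1 / (1 - q)) * fps_nth (hl_series {1..i}) k"
    by (auto simp: hall_littlewood_eq_hl_series)
  have graded: "graded n (hl_series {1..i})"
    using i by (intro graded_hl_series) auto
  then have "homogeneous (0 + k) h"
    using graded unfolding h graded_def by (intro homogeneous_mult homogeneous_const) blast
  moreover have "h \<in> carrier (mpoly_ring n)"
    using graded unfolding h graded_def by (intro carrier_mult carrier_const) blast
  moreover have "leading_form_in (vanishing_ideal n (point_set n k \<alpha>)) k h"
    unfolding h using assms(1,2,3) i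
    by (intro leading_form_const_mult[OF vanishing_ideal_ideal] leading_form_hl_series) auto
  ultimately show ?thesis
    by auto
next
  assume "h \<in> (\<lambda>d. elem_sym d n) ` {n - k + 1..n}"
  then obtain d where d: "d \<in> {n - k + 1..n}" and h: "h = elem_sym d n"
    by blast
  have "graded n (elem_series {1..n})"
    by (rule graded_elem_series) simp
  then have "homogeneous d h \<and> h \<in> carrier (mpoly_ring n)"
    unfolding h elem_series_eq_elem_sym[symmetric] graded_def by blast
  then show ?thesis
    using leading_form_elem_sym[OF assms(2) d] unfolding h by blast
qed

theorem theorem2p4:
  fixes n k :: nat and \<alpha> :: "nat \<Rightarrow> rat"
  assumes "1 \<le> k" and "k \<le> n"
    and "inj_on \<alpha> {1..k}"
    and "\<forall>r\<in>{1..k}. \<alpha> r \<noteq> 0"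
  shows "T_ideal n (point_set n k \<alpha>) = I_ideal n k \<and>
    mpoly_ring n Quot T_ideal n (point_set n k \<alpha>) = R_quot n k"
proof -
  let ?C = "carrier (mpoly_ring n) :: F mpoly set"
  let ?gens = "hall_littlewood k ` {1..n} \<union> (\<lambda>d. elem_sym d n) ` {n - k + 1..n}"
  define I where "I = I_ideal n k"
  define V where "V = vanishing_ideal n (point_set n k \<alpha>)"
  interpret R: cring "mpoly_ring n :: F mpoly ring"
    by (rule mpoly_ring_cring)
  have V: "ideal V (mpoly_ring n)"
    unfolding V_def by (rule vanishing_ideal_ideal)
  have gens: "\<exists>d. homogeneous d h \<and> h \<in> ?C \<and> leading_form_in V d h" if "h \<in> ?gens" for h
    unfolding V_def by (rule generators_leading_forms[OF assms(1,3,4) that])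
  then have gens_C: "?gens \<subseteq> ?C"
    by fast
  have I: "ideal I (mpoly_ring n)"
    unfolding I_def I_ideal_def by (rule R.genideal_ideal[OF gens_C])
  have gens_I: "?gens \<subseteq> I"
    unfolding I_def I_ideal_def by (rule R.genideal_self[OF gens_C])
  have tops_C: "top_component ` (V - {0}) \<subseteq> ?C"
    using ideal_carrier[OF V] by (auto simp: top_component_eq intro: component_carrier)
  \<comment> \<open>\<open>I\<close> is a homogeneous ideal, and all its forms are leading forms of \<open>V\<close>.\<close>
  have lead: "component d h \<in> I \<and> leading_form_in V d (component d h)" if "h \<in> I" for h d
  proof -
    let ?G = "{f \<in> ?C. \<forall>d. component d f \<in> I \<and> leading_form_in V d (component d f)}"
    have G: "ideal ?G (mpoly_ring n)"
      by (rule leading_forms_ideal[OF V I])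
    have zero: "leading_form_in V d 0" for d
      unfolding leading_form_in_def using ideal_0[OF V] by (intro bexI[of _ 0]) auto
    have "h \<in> ?G" if h: "h \<in> ?gens" for h
    proof -
      obtain d where d: "homogeneous d h" "h \<in> ?C" "leading_form_in V d h"
        using gens[OF h] by blast
      have "h \<in> I"
        using h gens_I by blast
      then show ?thesis
        using d zero ideal_0[OF I] by (simp add: component_homogeneous[OF d(1)])
    qed
    then have "Idl\<^bsub>mpoly_ring n\<^esub> ?gens \<subseteq> ?G"
      by (intro R.genideal_minimal[OF G] subsetI)
    moreover have "h \<in> Idl\<^bsub>mpoly_ring n\<^esub> ?gens"
      using that unfolding I_def I_ideal_def .
    ultimately show ?thesis
      by blast
  qed
  have "?gens \<subseteq> T_ideal n (point_set n k \<alpha>)"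
  proof
    fix h assume "h \<in> ?gens"
    then obtain d where "leading_form_in V d h"
      using gens by blast
    then have "h = 0 \<or> h \<in> top_component ` (V - {0})"
      using leading_form_top_component by blast
    then show "h \<in> T_ideal n (point_set n k \<alpha>)"
      using R.genideal_self[OF tops_C] ideal_0[OF R.genideal_ideal[OF tops_C]]
      unfolding T_ideal_def V_def[symmetric] by blast
  qed
  then have "I \<subseteq> T_ideal n (point_set n k \<alpha>)"
    unfolding I_def I_ideal_def
    using R.genideal_ideal[OF tops_C] unfolding T_ideal_def V_def[symmetric]
    by (intro R.genideal_minimal)
  moreover have "T_ideal n (point_set n k \<alpha>) \<subseteq> I"
  proof -
    have hl: "fps_nth (hl_series {Suc 0..l}) k \<in> I" if "l \<in> {Suc 0..n}" for l
    proof -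
      have "hall_littlewood k l \<in> I"
        using gens_I that by auto
      then show ?thesis
        using hl_series_eq_hall_littlewood[of l k] ideal_mult[OF I carrier_const] by simp
    qed
    have elem: "fps_nth (elem_series {Suc 0..n}) d \<in> I" if "n < d + k" for d
    proof (cases "d \<le> n")
      case True
      then have "d \<in> {n - k + 1..n}"
        using that \<open>k \<le> n\<close> by simp
      then have "elem_sym d n \<in> I"
        using gens_I by blast
      then show ?thesis
        using elem_series_eq_elem_sym[of n d] by simp
    next
      case False
      then show ?thesis
        by (simp add: elem_series_nth_eq_0 ideal_0[OF I])
    qed
    obtain M where M: "finite M" "card M \<le> cover_number k n k"
      and span: "\<And>f. f \<in> ?C \<Longrightarrow> \<exists>p\<in>?C. keys p \<subseteq> M \<and> f - p \<in> I"
      using spanning_monomials[OF I assms(1), of 0 n k] hl elem by auto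
    have reduce: "\<exists>p. keys p \<subseteq> M \<and> f - p \<in> V \<and> component (total_degree f) (f - p) \<in> I"
      if f: "f \<in> ?C" for f
    proof -
      have "\<exists>p\<in>?C. keys p \<subseteq> M \<and> f - p \<in> V \<and> (\<forall>e\<ge>Suc (total_degree f). component e p = 0) \<and>
        component (Suc (total_degree f) - 1) (f - p) \<in> I"
      proof (rule reduction_modulo_vanishing[OF V I])
        show "component d h \<in> I \<and> leading_form_in V d (component d h)" if "h \<in> I" for h d
          by (rule lead[OF that])
        show "\<exists>p\<in>?C. keys p \<subseteq> M \<and> f - p \<in> I" if "f \<in> ?C" for f
          by (rule span[OF that])
        show "component e f = 0" if "e \<ge> Suc (total_degree f)" for e
          by (rule component_above_total_degree) (use that in simp)
      qed (rule f)
      then show ?thesis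
        by auto
    qed
    obtain Y where Y: "finite Y" "Y \<subseteq> point_set n k \<alpha>" "cover_number k n k \<le> card Y"
      using point_set_large[OF assms(3,4)] by blast
    have vanish: "eval y f = 0" if "f \<in> V" "y \<in> Y" for f y
      using that Y(2) by (auto simp: V_def vanishing_ideal_def)
    \<comment> \<open>Reduction does not change values on the points, so polynomials supported on \<open>M\<close> separate them.\<close>
    have sep: "\<exists>p. keys p \<subseteq> M \<and> (\<forall>z\<in>Y. eval z p = (if z = y then 1 else 0))" if "y \<in> Y" for y
    proof -
      have "Y \<subseteq> {1..n} \<rightarrow>\<^sub>E UNIV"
        using Y(2) by (auto simp: point_set_def)
      then obtain f where f: "f \<in> ?C" "\<forall>z\<in>Y. eval z f = (if z = y then 1 else 0)"
        using separating_polynomial[OF Y(1) _ \<open>y \<in> Y\<close>] by blast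
      obtain p where p: "keys p \<subseteq> M" "f - p \<in> V"
        using reduce[OF f(1)] by blast
      have "eval z p = eval z f" if "z \<in> Y" for z
        using vanish[OF p(2) that] by simp
      then show ?thesis
        using p(1) f(2) by auto
    qed
    have "top_component f \<in> I" if f: "f \<in> V" for f
    proof -
      obtain p where p: "keys p \<subseteq> M" "f - p \<in> V" "component (total_degree f) (f - p) \<in> I"
        using reduce[OF ideal_carrier[OF V f]] by blast
      \<comment> \<open>The remainder \<open>p\<close> of \<open>f\<close> vanishes on the points, hence is zero.\<close>
      have "f - (f - p) \<in> V"
        by (rule ideal_diff[OF V f p(2)])
      then have "p \<in> V"
        by simp
      have "p = 0"
      proof (rule vanishing_eq_0[OF M(1) Y(1) order_trans[OF M(2) Y(3)] _ p(1)])
        show "eval y p = 0" if "y \<in> Y" for y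
          by (rule vanish[OF \<open>p \<in> V\<close> that])
      qed (rule sep)
      then show ?thesis
        using p(3) by (simp add: top_component_eq)
    qed
    then show ?thesis
      unfolding T_ideal_def V_def[symmetric] by (intro R.genideal_minimal[OF I]) blast
  qed
  ultimately have "T_ideal n (point_set n k \<alpha>) = I_ideal n k"
    unfolding I_def by blast
  then show ?thesis
    by (simp add: R_quot_def)
qed

end
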